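(* Let $\mathbb{K}$ be an algebraically closed field of characteristic different from $2$ and $3$. For any $\alpha_1,\alpha_2,\alpha_3\in\mathbb{K}$, the algebra $\mathcal{T}(\alpha_1,\alpha_2,\alpha_3)$ is isomorphic to the quotient of an Ore extension $$\mathcal{K}(\alpha_1,\alpha_2,\alpha_3)[d;\partial,\sigma]/(d^2-\alpha_1),$$ where $\sigma$ is the algebra automorphism of $\mathcal{K}(\alpha_1,\alpha_2,\alpha_3)$ with $$\sigma(a)=-c,\quad \sigma(b)=-a,\quad \sigma(c)=-b,$$ and $\partial$ is the $(\sigma,\mathrm{id})$-skew derivation of $\mathcal{K}(\alpha_1,\alpha_2,\alpha_3)$ given by $$\partial(a)=\alpha_2-ac,\quad \partial(b)=\alpha_2-ba,\quad \partial(c)=\alpha_2-cb.$$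
   Context: $\mathcal{K}(\alpha_1,\alpha_2,\alpha_3)$ denotes the associative unital $\mathbb{K}$-algebra given by generators $a,b,c,y$ and relations $$a^2=b^2=c^2=\alpha_1,\qquad ab+bc+ca=\alpha_2,\qquad ac+cb+ba=\alpha_2+y,\qquad y^3=\alpha_3.$$ $\mathcal{T}(\alpha_1,\alpha_2,\alpha_3)$ denotes the associative unital $\mathbb{K}$-algebra given by generators $a,b,c,d$ and relations $$a^2=b^2=c^2=d^2=\alpha_1,$$ $$ca+bc+ab=\alpha_2,\quad da+cd+ac=\alpha_2,\quad db+ba+ad=\alpha_2,\quad dc+cb+bd=\alpha_2,$$ $$(cb+ba+ac-\alpha_2)^3=\alpha_3.$$ For an algebra $R$ with automorphism $\sigma$, a $(\sigma,\mathrm{id})$-skew derivation is a linear map $\partial\colon R\to R$ with $\partial(xz)=\partial(x)z+\sigma(x)\partial(z)$ for all $x,z\in R$. The Ore extension $R[d;\partial,\sigma]$ is the algebra which is free as a left $R$-module with basis $(d^k)_{k\geq 0}$ and with multiplication determined by $dx=\sigma(x)d+\partial(x)$ for $x\in R$. $(d^2-\alpha_1)$ denotes the two-sided ideal generated by $d^2-\alpha_1$. *)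

theory Defs
  imports
    "HOL-Library.Poly_Mapping"
    "HOL-Computational_Algebra.Polynomial"
    "HOL-Algebra.QuotRing"
    "HOL-Algebra.UnivPoly"
    "HOL-Algebra.Bij"
begin

text \<open>
  An associative unital algebra over a field, given as a type \<open>'k\<close>, is a record of type
  \<open>('k, 'a) module\<close>: the ring fields together with the scalar multiplication by \<open>'k\<close>.
  (The locale \<^locale>\<open>algebra\<close> cannot be used, since it requires commutativity.)
\<close>

subsection \<open>Free algebras\<close>

text \<open>
  The free monoid is wrapped into a new type because the type of lists has competing additive
  structures in the library (pointwise addition in \<open>HOL-Library.ListVector\<close>).
\<close>

datatype 'a fword = Word (letters: "'a list")

instantiation fword :: (type) monoid_add
begin

definition zero_fword :: "'a fword" where
  "0 = Word []"

definition plus_fword :: "'a fword \<Rightarrow> 'a fword \<Rightarrow> 'a fword" where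
  "u + v = Word (letters u @ letters v)"

instance
  by standard (simp_all add: zero_fword_def plus_fword_def)

end

text \<open>The monoid algebra of the free monoid; its product is the one of \<^type>\<open>poly_mapping\<close>.\<close>

type_synonym ('g, 'k) free = "'g fword \<Rightarrow>\<^sub>0 'k"

definition cst :: "'k \<Rightarrow> ('g, 'k::field) free" where
  "cst c = Poly_Mapping.single 0 c"

definition gen :: "'g \<Rightarrow> ('g, 'k::field) free" where
  "gen x = Poly_Mapping.single (Word [x]) 1"

definition free_alg :: "('k::field, ('g, 'k) free) module" where
  "free_alg =
    \<lparr>carrier = UNIV, mult = (*), one = 1, zero = 0, add = (+), smult = (\<lambda>c f. cst c * f)\<rparr>"


subsection \<open>Quotients, presentations and morphisms of algebras\<close>

text \<open>\<^const>\<open>FactRing\<close>, extended by the induced scalar multiplication.\<close>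

definition alg_quot :: "('k, 'a) module \<Rightarrow> 'a set \<Rightarrow> ('k, 'a set) module" where
  "alg_quot A I =
    \<lparr>carrier = carrier (A Quot I), mult = mult (A Quot I), one = one (A Quot I),
     zero = zero (A Quot I), add = add (A Quot I),
     smult = (\<lambda>c X. \<Union>x\<in>X. I +>\<^bsub>A\<^esub> (c \<odot>\<^bsub>A\<^esub> x))\<rparr>"

text \<open>A set \<open>S\<close> of elements of the free algebra stands for the relations \<open>s = 0\<close>, \<open>s \<in> S\<close>.
  \<^const>\<open>genideal\<close> is the two-sided ideal.\<close>

definition presented_alg :: "('g, 'k::field) free set \<Rightarrow> ('k, ('g, 'k) free set) module" where
  "presented_alg S = alg_quot free_alg (Idl\<^bsub>free_alg\<^esub> S)"

definition pgen :: "('g, 'k::field) free set \<Rightarrow> 'g \<Rightarrow> ('g, 'k) free set" where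
  "pgen S x = (Idl\<^bsub>free_alg\<^esub> S) +>\<^bsub>free_alg\<^esub> gen x"

definition scalar :: "('k, 'a) module \<Rightarrow> 'k \<Rightarrow> 'a" where
  "scalar A c = c \<odot>\<^bsub>A\<^esub> \<one>\<^bsub>A\<^esub>"

definition alg_hom :: "('k, 'a) module \<Rightarrow> ('k, 'b) module \<Rightarrow> ('a \<Rightarrow> 'b) set" where
  "alg_hom A B =
    {h \<in> ring_hom A B. \<forall>c. \<forall>x\<in>carrier A. h (c \<odot>\<^bsub>A\<^esub> x) = c \<odot>\<^bsub>B\<^esub> h x}"

definition alg_isomorphic :: "('k, 'a) module \<Rightarrow> ('k, 'b) module \<Rightarrow> bool" where
  "alg_isomorphic A B \<longleftrightarrow> (\<exists>h\<in>alg_hom A B. bij_betw h (carrier A) (carrier B))"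

text \<open>As in \<^const>\<open>auto\<close>, maps on a carrier are taken to be extensional, so that each of them is
  represented by exactly one HOL function.\<close>

definition alg_auto :: "('k, 'a) module \<Rightarrow> ('a \<Rightarrow> 'a) set" where
  "alg_auto A = alg_hom A A \<inter> Bij (carrier A)"

definition skew_derivation :: "('k, 'a) module \<Rightarrow> ('a \<Rightarrow> 'a) \<Rightarrow> ('a \<Rightarrow> 'a) set" where
  "skew_derivation A \<sigma> =
    {\<delta> \<in> extensional (carrier A) \<inter> (carrier A \<rightarrow> carrier A).
      (\<forall>x\<in>carrier A. \<forall>z\<in>carrier A. \<delta> (x \<oplus>\<^bsub>A\<^esub> z) = \<delta> x \<oplus>\<^bsub>A\<^esub> \<delta> z) \<and>
      (\<forall>c. \<forall>x\<in>carrier A. \<delta> (c \<odot>\<^bsub>A\<^esub> x) = c \<odot>\<^bsub>A\<^esub> \<delta> x) \<and>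
      (\<forall>x\<in>carrier A. \<forall>z\<in>carrier A.
         \<delta> (x \<otimes>\<^bsub>A\<^esub> z) = (\<delta> x \<otimes>\<^bsub>A\<^esub> z) \<oplus>\<^bsub>A\<^esub> (\<sigma> x \<otimes>\<^bsub>A\<^esub> \<delta> z))}"


subsection \<open>Ore extensions\<close>

text \<open>
  As a left \<open>R\<close>-module, \<open>R[d; \<delta>, \<sigma>]\<close> is the module underlying \<^term>\<open>UP R\<close>: a finitely supported
  sequence \<open>p\<close> stands for the sum of the \<open>p\<^sub>i d\<^sup>i\<close>.  The rule \<open>d x = \<sigma>(x) d + \<delta>(x)\<close>
  forces the left multiplication by \<open>d\<close> to be
  \<open>\<Sum>\<^sub>n q\<^sub>n d\<^sup>n \<mapsto> \<Sum>\<^sub>n (\<sigma>(q\<^sub>n) d\<^sup>n\<^sup>+\<^sup>1 + \<delta>(q\<^sub>n) d\<^sup>n)\<close>,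
  and hence the product of \<open>p\<close> and \<open>q\<close> to be the sum of the \<open>p\<^sub>i (d\<^sup>i q)\<close>.
\<close>

definition ore_shift ::
  "('k, 'a) module \<Rightarrow> ('a \<Rightarrow> 'a) \<Rightarrow> ('a \<Rightarrow> 'a) \<Rightarrow> (nat \<Rightarrow> 'a) \<Rightarrow> nat \<Rightarrow> 'a" where
  "ore_shift R \<delta> \<sigma> q =
    (\<lambda>n. case n of 0 \<Rightarrow> \<delta> (q 0) | Suc m \<Rightarrow> \<sigma> (q m) \<oplus>\<^bsub>R\<^esub> \<delta> (q (Suc m)))"

definition ore_mult ::
  "('k, 'a) module \<Rightarrow> ('a \<Rightarrow> 'a) \<Rightarrow> ('a \<Rightarrow> 'a) \<Rightarrow> (nat \<Rightarrow> 'a) \<Rightarrow> (nat \<Rightarrow> 'a) \<Rightarrow> nat \<Rightarrow> 'a" where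
  "ore_mult R \<delta> \<sigma> p q =
    (\<lambda>n. \<Oplus>\<^bsub>R\<^esub>i\<in>{i. p i \<noteq> \<zero>\<^bsub>R\<^esub>}. p i \<otimes>\<^bsub>R\<^esub> ((ore_shift R \<delta> \<sigma> ^^ i) q) n)"

definition ore_ext ::
  "('k, 'a) module \<Rightarrow> ('a \<Rightarrow> 'a) \<Rightarrow> ('a \<Rightarrow> 'a) \<Rightarrow> ('k, nat \<Rightarrow> 'a) module" where
  "ore_ext R \<delta> \<sigma> =
    \<lparr>carrier = carrier (UP R), mult = ore_mult R \<delta> \<sigma>, one = one (UP R), zero = zero (UP R),
     add = add (UP R), smult = (\<lambda>c p n. c \<odot>\<^bsub>R\<^esub> p n)\<rparr>"

definition ore_var :: "('k, 'a) module \<Rightarrow> nat \<Rightarrow> 'a" where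
  "ore_var R = up_ring.monom (UP R) \<one>\<^bsub>R\<^esub> 1"

text \<open>The defining rule does hold in \<^const>\<open>ore_ext\<close>; the coefficients of \<open>R\<close> are embedded as the
  monomials of degree \<open>0\<close>, and multiplication by them from the left is coefficientwise.\<close>

lemma ore_mult_coefficient:
  assumes "ring R" "r \<in> carrier R" "q \<in> carrier (UP R)"
  shows "ore_mult R \<delta> \<sigma> (up_ring.monom (UP R) r 0) q = r \<odot>\<^bsub>UP R\<^esub> q"
proof -
  interpret ring R by fact
  have q: "q n \<in> carrier R" for n
    using assms(3) by (auto simp: UP_def up_def)
  have supp: "{i. (if i = (0::nat) then r else \<zero>\<^bsub>R\<^esub>) \<noteq> \<zero>\<^bsub>R\<^esub>} = (if r = \<zero>\<^bsub>R\<^esub> then {} else {0})"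
    by auto
  show ?thesis
    using assms q by (auto simp: UP_def ore_mult_def supp fun_eq_iff)
qed

lemma ore_rule:
  assumes "ring R" "\<sigma> \<in> carrier R \<rightarrow> carrier R" "\<delta> \<in> carrier R \<rightarrow> carrier R"
    and zero: "\<sigma> \<zero>\<^bsub>R\<^esub> = \<zero>\<^bsub>R\<^esub>" "\<delta> \<zero>\<^bsub>R\<^esub> = \<zero>\<^bsub>R\<^esub>" and x: "x \<in> carrier R"
  shows "ore_mult R \<delta> \<sigma> (ore_var R) (up_ring.monom (UP R) x 0) =
    ore_mult R \<delta> \<sigma> (up_ring.monom (UP R) (\<sigma> x) 0) (ore_var R)
      \<oplus>\<^bsub>UP R\<^esub> up_ring.monom (UP R) (\<delta> x) 0"
proof -
  interpret ring R by fact
  have trivial: "y = \<zero>\<^bsub>R\<^esub>" if "\<one>\<^bsub>R\<^esub> = \<zero>\<^bsub>R\<^esub>" "y \<in> carrier R" for y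
    using that one_zeroD by auto
  interpret UP_ring R "UP R" by unfold_locales
  have sx: "\<sigma> x \<in> carrier R" and dx: "\<delta> x \<in> carrier R"
    using assms by auto
  have coeff_monom: "up_ring.monom (UP R) r k = (\<lambda>i. if i = k then r else \<zero>\<^bsub>R\<^esub>)"
    if "r \<in> carrier R" for r k
    using that by (simp add: UP_def)
  have shift: "ore_shift R \<delta> \<sigma> (up_ring.monom (UP R) x 0) n \<in> carrier R" for n
    using assms x by (auto simp: ore_shift_def coeff_monom split: nat.split)
  have supp: "{i. (if i = Suc 0 then \<one>\<^bsub>R\<^esub> else \<zero>\<^bsub>R\<^esub>) \<noteq> \<zero>\<^bsub>R\<^esub>} =
      (if \<one>\<^bsub>R\<^esub> = \<zero>\<^bsub>R\<^esub> then {} else {Suc 0})"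
    by auto
  have "ore_mult R \<delta> \<sigma> (ore_var R) (up_ring.monom (UP R) x 0) =
      ore_shift R \<delta> \<sigma> (up_ring.monom (UP R) x 0)"
    using shift trivial[OF _ shift]
    by (auto simp: ore_mult_def ore_var_def coeff_monom[of "\<one>\<^bsub>R\<^esub>"] supp fun_eq_iff)
  also have "\<dots> = \<sigma> x \<odot>\<^bsub>UP R\<^esub> ore_var R \<oplus>\<^bsub>UP R\<^esub> up_ring.monom (UP R) (\<delta> x) 0"
  proof -
    have v: "ore_var R \<in> carrier (UP R)" and m: "up_ring.monom (UP R) (\<delta> x) 0 \<in> carrier (UP R)"
      using dx by (simp_all add: ore_var_def)
    have s: "\<sigma> x \<odot>\<^bsub>UP R\<^esub> ore_var R = (\<lambda>i. if i = 1 then \<sigma> x else \<zero>\<^bsub>R\<^esub>)"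
      using sx v by (auto simp: ore_var_def coeff_monom fun_eq_iff UP_def)
    have "\<sigma> x \<odot>\<^bsub>UP R\<^esub> ore_var R \<in> carrier (UP R)"
      using sx v by simp
    then show ?thesis
      using m x sx dx zero unfolding s coeff_monom[OF dx] coeff_monom[OF x]
      by (auto simp: ore_shift_def UP_def fun_eq_iff split: nat.split)
  qed
  also have "\<sigma> x \<odot>\<^bsub>UP R\<^esub> ore_var R = ore_mult R \<delta> \<sigma> (up_ring.monom (UP R) (\<sigma> x) 0) (ore_var R)"
    by (rule ore_mult_coefficient[symmetric]) (use sx assms in \<open>simp_all add: ore_var_def\<close>)
  finally show ?thesis .
qed


subsection \<open>The algebras \<open>\<K>\<close> and \<open>\<T>\<close>\<close>

datatype K_gen = K_a | K_b | K_c | K_y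

definition K_rels :: "'k::field \<Rightarrow> 'k \<Rightarrow> 'k \<Rightarrow> (K_gen, 'k) free set" where
  "K_rels \<alpha>1 \<alpha>2 \<alpha>3 =
    (let a = gen K_a; b = gen K_b; c = gen K_c; y = gen K_y in
     {a^2 - cst \<alpha>1, b^2 - cst \<alpha>1, c^2 - cst \<alpha>1,
      a*b + b*c + c*a - cst \<alpha>2,
      a*c + c*b + b*a - (cst \<alpha>2 + y),
      y^3 - cst \<alpha>3})"

definition K_alg :: "'k::field \<Rightarrow> 'k \<Rightarrow> 'k \<Rightarrow> ('k, (K_gen, 'k) free set) module" where
  "K_alg \<alpha>1 \<alpha>2 \<alpha>3 = presented_alg (K_rels \<alpha>1 \<alpha>2 \<alpha>3)"

datatype T_gen = T_a | T_b | T_c | T_d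

definition T_rels :: "'k::field \<Rightarrow> 'k \<Rightarrow> 'k \<Rightarrow> (T_gen, 'k) free set" where
  "T_rels \<alpha>1 \<alpha>2 \<alpha>3 =
    (let a = gen T_a; b = gen T_b; c = gen T_c; d = gen T_d in
     {a^2 - cst \<alpha>1, b^2 - cst \<alpha>1, c^2 - cst \<alpha>1, d^2 - cst \<alpha>1,
      c*a + b*c + a*b - cst \<alpha>2,
      d*a + c*d + a*c - cst \<alpha>2,
      d*b + b*a + a*d - cst \<alpha>2,
      d*c + c*b + b*d - cst \<alpha>2,
      (c*b + b*a + a*c - cst \<alpha>2)^3 - cst \<alpha>3})"

definition T_alg :: "'k::field \<Rightarrow> 'k \<Rightarrow> 'k \<Rightarrow> ('k, (T_gen, 'k) free set) module" where
  "T_alg \<alpha>1 \<alpha>2 \<alpha>3 = presented_alg (T_rels \<alpha>1 \<alpha>2 \<alpha>3)"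

definition is_sigma ::
  "'k::field \<Rightarrow> 'k \<Rightarrow> 'k \<Rightarrow> ((K_gen, 'k) free set \<Rightarrow> (K_gen, 'k) free set) \<Rightarrow> bool" where
  "is_sigma \<alpha>1 \<alpha>2 \<alpha>3 \<sigma> \<longleftrightarrow>
    (let K = K_alg \<alpha>1 \<alpha>2 \<alpha>3; x = pgen (K_rels \<alpha>1 \<alpha>2 \<alpha>3); a = x K_a; b = x K_b; c = x K_c in
     \<sigma> \<in> alg_auto K \<and> \<sigma> a = \<ominus>\<^bsub>K\<^esub> c \<and> \<sigma> b = \<ominus>\<^bsub>K\<^esub> a \<and> \<sigma> c = \<ominus>\<^bsub>K\<^esub> b)"

definition is_partial ::
  "'k::field \<Rightarrow> 'k \<Rightarrow> 'k \<Rightarrow> ((K_gen, 'k) free set \<Rightarrow> (K_gen, 'k) free set) \<Rightarrow>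
    ((K_gen, 'k) free set \<Rightarrow> (K_gen, 'k) free set) \<Rightarrow> bool" where
  "is_partial \<alpha>1 \<alpha>2 \<alpha>3 \<sigma> \<delta> \<longleftrightarrow>
    (let K = K_alg \<alpha>1 \<alpha>2 \<alpha>3; x = pgen (K_rels \<alpha>1 \<alpha>2 \<alpha>3); a = x K_a; b = x K_b; c = x K_c in
     \<delta> \<in> skew_derivation K \<sigma> \<and>
     \<delta> a = scalar K \<alpha>2 \<ominus>\<^bsub>K\<^esub> a \<otimes>\<^bsub>K\<^esub> c \<and>
     \<delta> b = scalar K \<alpha>2 \<ominus>\<^bsub>K\<^esub> b \<otimes>\<^bsub>K\<^esub> a \<and>
     \<delta> c = scalar K \<alpha>2 \<ominus>\<^bsub>K\<^esub> c \<otimes>\<^bsub>K\<^esub> b)"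

text \<open>\<open>R[d; \<delta>, \<sigma>]/(d\<^sup>2 - \<alpha>)\<close>\<close>

definition ore_quot ::
  "('k, 'a) module \<Rightarrow> ('a \<Rightarrow> 'a) \<Rightarrow> ('a \<Rightarrow> 'a) \<Rightarrow> 'k \<Rightarrow> ('k, (nat \<Rightarrow> 'a) set) module" where
  "ore_quot R \<delta> \<sigma> \<alpha> =
    (let S = ore_ext R \<delta> \<sigma>; d = ore_var R in
     alg_quot S (Idl\<^bsub>S\<^esub> {d [^]\<^bsub>S\<^esub> (2::nat) \<ominus>\<^bsub>S\<^esub> scalar S \<alpha>}))"

end

(*
  Both sigma and partial lift to the free algebra on a, b, c, y: the lift of sigma permutes the
  relations of K up to the order of summation, and the lift of partial maps each relation into the
  ideal they generate, so both descend to K and are determined there by their values on a, b, c (y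
  is a polynomial in these).  In T the relations containing d say exactly that
  d x = sigma(x) d + partial(x) for x = a, b, c; hence K -> T extends to the Ore extension by
  d |-> d and kills d^2 - alpha1.  Conversely a, b, c, d in the quotient of the Ore extension
  satisfy the relations of T.  The two resulting homomorphisms are inverse to each other because
  they are so on generators.
*)
theory Submission
  imports Defs
begin

subsection \<open>Algebras, quotients and morphisms\<close>

text \<open>No basis of either algebra is computed: elements are handled through representatives in
  free algebras, and an identity in a quotient is membership of a difference in the ideal. The
  delicate point is y, which is a generator of K but not a letter of T, and whose images under sigma
  and partial are not prescribed. They are forced by y = ac + cb + ba - \<alpha>2: sigma permutes
  ac, cb, ba cyclically, so y is fixed, and the product rule sends ac + cb + ba to a combination of
  a^2 - \<alpha>1, b^2 - \<alpha>1, c^2 - \<alpha>1, so partial(y) = 0. The same equation makes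
  induction over a, b, c sufficient in K, although the free algebra over K has a fourth letter. For
  the Ore extension everything rests on one operator, left multiplication by d on coefficient
  sequences: associativity reduces to the fact that this operator commutes with right
  multiplications, and multiplicativity of the map to T to the fact that it becomes left
  multiplication by the image of d.\<close>

locale nc_algebra = ring A for A :: "('k::field, 'a) module" (structure) +
  assumes smult_closed [simp]: "x \<in> carrier A \<Longrightarrow> c \<odot> x \<in> carrier A"
    and smult_l_distr: "x \<in> carrier A \<Longrightarrow> (c + d) \<odot> x = c \<odot> x \<oplus> d \<odot> x"
    and smult_r_distr: "x \<in> carrier A \<Longrightarrow> y \<in> carrier A \<Longrightarrow> c \<odot> (x \<oplus> y) = c \<odot> x \<oplus> c \<odot> y"
    and smult_assoc: "x \<in> carrier A \<Longrightarrow> (c * d) \<odot> x = c \<odot> (d \<odot> x)"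
    and smult_one [simp]: "x \<in> carrier A \<Longrightarrow> 1 \<odot> x = x"
    and smult_mult_left: "x \<in> carrier A \<Longrightarrow> y \<in> carrier A \<Longrightarrow> (c \<odot> x) \<otimes> y = c \<odot> (x \<otimes> y)"
    and smult_mult_right: "x \<in> carrier A \<Longrightarrow> y \<in> carrier A \<Longrightarrow> x \<otimes> (c \<odot> y) = c \<odot> (x \<otimes> y)"
begin

lemma scalar_closed [simp]: "scalar A c \<in> carrier A"
  by (simp add: scalar_def)

lemma scalar_mult: "x \<in> carrier A \<Longrightarrow> scalar A c \<otimes> x = c \<odot> x"
  by (simp add: scalar_def smult_mult_left)

lemma smult_zero_left [simp]: "x \<in> carrier A \<Longrightarrow> 0 \<odot> x = \<zero>"
  using smult_l_distr[of x 0 0] by (simp add: add.l_cancel_one')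

lemma smult_zero_right [simp]: "c \<odot> \<zero> = \<zero>"
  using smult_r_distr[of \<zero> \<zero> c] by (simp add: add.l_cancel_one')

lemma minus_eq_zero_iff: "x \<in> carrier A \<Longrightarrow> y \<in> carrier A \<Longrightarrow> x \<ominus> y = \<zero> \<longleftrightarrow> x = y"
  by (metis a_inv_closed minus_eq minus_equality minus_minus r_neg)

text \<open>Since \<open>c \<odot> x\<close> is the ring product of \<open>scalar A c\<close> and
  \<open>x\<close>, ideals of the underlying ring absorb scalars, so ring-theoretic ideals and
  quotients serve for algebras.\<close>

lemma ideal_smult: "ideal I A \<Longrightarrow> x \<in> I \<Longrightarrow> c \<odot> x \<in> I"
  by (metis scalar_mult ideal.I_l_closed ideal.Icarr scalar_closed)

end

text \<open>Moves the ring axioms between records of different types that share their ring fields,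
  as \<open>alg_quot A I\<close> and \<open>A Quot I\<close> do.\<close>

lemma ring_cong:
  assumes "ring R" "carrier S = carrier R" "mult S = mult R" "one S = one R" "zero S = zero R"
    "add S = add R"
  shows "ring S"
proof -
  interpret ring R by fact
  show ?thesis
    by (intro ringI abelian_groupI monoidI)
      (auto simp: assms(2-) a_ac m_assoc l_distr r_distr intro: add.l_inv_ex)
qed

lemma alg_homI:
  assumes "\<And>x. x \<in> carrier A \<Longrightarrow> h x \<in> carrier B"
    and "\<And>x y. x \<in> carrier A \<Longrightarrow> y \<in> carrier A \<Longrightarrow> h (x \<otimes>\<^bsub>A\<^esub> y) = h x \<otimes>\<^bsub>B\<^esub> h y"
    and "\<And>x y. x \<in> carrier A \<Longrightarrow> y \<in> carrier A \<Longrightarrow> h (x \<oplus>\<^bsub>A\<^esub> y) = h x \<oplus>\<^bsub>B\<^esub> h y"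
    and "h \<one>\<^bsub>A\<^esub> = \<one>\<^bsub>B\<^esub>"
    and "\<And>c x. x \<in> carrier A \<Longrightarrow> h (c \<odot>\<^bsub>A\<^esub> x) = c \<odot>\<^bsub>B\<^esub> h x"
  shows "h \<in> alg_hom A B"
  using assms by (auto simp: alg_hom_def ring_hom_def)

lemma alg_homD:
  assumes "h \<in> alg_hom A B"
  shows "x \<in> carrier A \<Longrightarrow> h x \<in> carrier B"
    and "x \<in> carrier A \<Longrightarrow> y \<in> carrier A \<Longrightarrow> h (x \<otimes>\<^bsub>A\<^esub> y) = h x \<otimes>\<^bsub>B\<^esub> h y"
    and "x \<in> carrier A \<Longrightarrow> y \<in> carrier A \<Longrightarrow> h (x \<oplus>\<^bsub>A\<^esub> y) = h x \<oplus>\<^bsub>B\<^esub> h y"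
    and "h \<one>\<^bsub>A\<^esub> = \<one>\<^bsub>B\<^esub>"
    and "x \<in> carrier A \<Longrightarrow> h (c \<odot>\<^bsub>A\<^esub> x) = c \<odot>\<^bsub>B\<^esub> h x"
  using assms by (auto simp: alg_hom_def ring_hom_def)

lemma alg_hom_comp: "h \<in> alg_hom A B \<Longrightarrow> g \<in> alg_hom B C \<Longrightarrow> g \<circ> h \<in> alg_hom A C"
  by (rule alg_homI) (simp_all add: alg_homD)

locale alg_morph = A: nc_algebra A + B: nc_algebra B
  for A :: "('k::field, 'a) module" and B :: "('k, 'b) module" and h +
  assumes alg_hom: "h \<in> alg_hom A B"
begin

sublocale ring_hom_ring A B h
  using alg_hom by unfold_locales (simp add: alg_hom_def)

lemmas hom_smult = alg_homD(5)[OF alg_hom]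

lemma hom_scalar: "h (scalar A c) = scalar B c"
  by (simp add: scalar_def hom_smult)

lemma hom_minus:
  "x \<in> carrier A \<Longrightarrow> y \<in> carrier A \<Longrightarrow> h (x \<ominus>\<^bsub>A\<^esub> y) = h x \<ominus>\<^bsub>B\<^esub> h y"
  unfolding a_minus_def by simp

lemma genideal_subset_kernel:
  assumes "S \<subseteq> carrier A" "\<And>x. x \<in> S \<Longrightarrow> h x = \<zero>\<^bsub>B\<^esub>" "x \<in> Idl\<^bsub>A\<^esub> S"
  shows "h x = \<zero>\<^bsub>B\<^esub>"
proof -
  have "S \<subseteq> a_kernel A B h"
    unfolding a_kernel_def' using assms(1,2) by blast
  then have "Idl\<^bsub>A\<^esub> S \<subseteq> a_kernel A B h"
    by (rule A.genideal_minimal[OF kernel_is_ideal])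
  then show ?thesis
    unfolding a_kernel_def' using assms(3) by blast
qed

end

section \<open>Quotient algebras and their universal property\<close>

lemma alg_quot_simps [simp]:
  "mult (alg_quot A I) = mult (A Quot I)" "one (alg_quot A I) = one (A Quot I)"
  "zero (alg_quot A I) = zero (A Quot I)" "add (alg_quot A I) = add (A Quot I)"
  "carrier (alg_quot A I) = carrier (A Quot I)"
  by (simp_all add: alg_quot_def)

context nc_algebra
begin

lemma alg_quot_carrier: "carrier (alg_quot A I) = (\<lambda>x. I +> x) ` carrier A"
  by (auto simp: FactRing_simps)

lemma alg_quot_smult:
  assumes "ideal I A" "x \<in> carrier A"
  shows "c \<odot>\<^bsub>alg_quot A I\<^esub> (I +> x) = I +> c \<odot> x"
proof -
  interpret I: ideal I A by fact
  \<comment> \<open>The scalar multiple of a coset is a union over all its representatives. Two of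
    them differ by some \<open>i\<close> in \<open>I\<close>, and \<open>c \<odot> i\<close> is
    again in \<open>I\<close>, so the union is over copies of one coset.\<close>
  have "I +> c \<odot> y = I +> c \<odot> x" if y: "y \<in> I +> x" for y
  proof -
    obtain i where i: "i \<in> I" "y = i \<oplus> x"
      using y by (auto simp: a_r_coset_def')
    have "c \<odot> y \<ominus> c \<odot> x = c \<odot> i"
      using i assms(2) I.Icarr by (simp add: smult_r_distr minus_eq a_assoc r_neg)
    then have "c \<odot> y \<ominus> c \<odot> x \<in> I"
      using ideal_smult[OF assms(1) i(1)] by simp
    then show ?thesis
      using assms i I.Icarr by (subst (asm) quotient_eq_iff_same_a_r_cos) auto
  qed
  moreover have "x \<in> I +> x"
    using assms(2) I.zero_closed by (force simp: a_r_coset_def')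
  ultimately have "(\<Union>y\<in>I +> x. I +> c \<odot> y) = I +> c \<odot> x"
    by blast
  then show ?thesis
    by (simp add: alg_quot_def)
qed

lemma alg_quot_proj_ops:
  assumes "ideal I A"
  shows "x \<in> carrier A \<Longrightarrow> y \<in> carrier A \<Longrightarrow> (I +> x) \<otimes>\<^bsub>A Quot I\<^esub> (I +> y) = I +> (x \<otimes> y)"
    and "x \<in> carrier A \<Longrightarrow> y \<in> carrier A \<Longrightarrow> (I +> x) \<oplus>\<^bsub>A Quot I\<^esub> (I +> y) = I +> (x \<oplus> y)"
    and "\<one>\<^bsub>A Quot I\<^esub> = I +> \<one>"
  using ring_hom_mult[OF ideal.rcos_ring_hom[OF assms]]
    ring_hom_add[OF ideal.rcos_ring_hom[OF assms]]
    ring_hom_one[OF ideal.rcos_ring_hom[OF assms]] by simp_all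

lemma alg_quot_nc_algebra:
  assumes "ideal I A"
  shows "nc_algebra (alg_quot A I)"
proof -
  have ring: "ring (alg_quot A I)"
    by (rule ring_cong[OF ideal.quotient_is_ring[OF assms]]) (simp_all add: alg_quot_def)
  note * = alg_quot_smult[OF assms] alg_quot_proj_ops[OF assms]
  show ?thesis
    by (intro nc_algebra.intro ring nc_algebra_axioms.intro; (unfold alg_quot_carrier)?)
      (auto simp: * smult_l_distr smult_r_distr smult_assoc smult_mult_left smult_mult_right)
qed

lemma alg_quot_proj_hom:
  assumes "ideal I A"
  shows "(+>) I \<in> alg_hom A (alg_quot A I)"
  by (rule alg_homI)
    (auto simp add: alg_quot_smult[OF assms] alg_quot_proj_ops[OF assms] alg_quot_carrier
      simp del: alg_quot_simps(5))

lemma alg_quot_proj_morph: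
  assumes "ideal I A"
  shows "alg_morph A (alg_quot A I) ((+>) I)"
  using assms nc_algebra_axioms
  by (intro alg_morph.intro alg_morph_axioms.intro alg_quot_nc_algebra alg_quot_proj_hom)

lemma alg_quot_proj_eq_zero_iff:
  assumes "ideal I A" "x \<in> carrier A"
  shows "I +> x = \<zero>\<^bsub>A Quot I\<^esub> \<longleftrightarrow> x \<in> I"
  using assms ideal.rcos_const_imp_mem a_rcos_zero by (auto simp: FactRing_def)

end

text \<open>A coset is sent to the value of \<open>h\<close> at a chosen representative; the choice
  is immaterial because \<open>h\<close> kills differences lying in \<open>I\<close>.\<close>

lemma (in alg_morph) alg_quot_lift:
  assumes "ideal I A" "\<And>x. x \<in> I \<Longrightarrow> h x = \<zero>\<^bsub>B\<^esub>"
  obtains g where "g \<in> alg_hom (alg_quot A I) B"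
    and "\<And>x. x \<in> carrier A \<Longrightarrow> g (I +>\<^bsub>A\<^esub> x) = h x"
proof
  define g where "g X = h (SOME x. x \<in> carrier A \<and> X = I +>\<^bsub>A\<^esub> x)" for X
  show g: "g (I +>\<^bsub>A\<^esub> x) = h x" if x: "x \<in> carrier A" for x
  proof -
    define y where "y = (SOME y. y \<in> carrier A \<and> I +>\<^bsub>A\<^esub> x = I +>\<^bsub>A\<^esub> y)"
    have y: "y \<in> carrier A" "I +>\<^bsub>A\<^esub> x = I +>\<^bsub>A\<^esub> y"
      using someI[of "\<lambda>y. y \<in> carrier A \<and> I +>\<^bsub>A\<^esub> x = I +>\<^bsub>A\<^esub> y" x] x by (auto simp: y_def)
    have "x \<ominus>\<^bsub>A\<^esub> y \<in> I"
      using A.quotient_eq_iff_same_a_r_cos[OF assms(1) x y(1)] y by simp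
    then have "h x \<ominus>\<^bsub>B\<^esub> h y = \<zero>\<^bsub>B\<^esub>"
      using assms(2) hom_minus[OF x y(1)] by simp
    then have "h x = h y"
      using B.minus_eq_zero_iff hom_closed x y(1) by blast
    then show ?thesis
      by (simp add: g_def flip: y_def)
  qed
  note * = A.alg_quot_smult[OF assms(1)] A.alg_quot_proj_ops[OF assms(1)]
  show "g \<in> alg_hom (alg_quot A I) B"
    by (rule alg_homI; (unfold A.alg_quot_carrier)?) (auto simp: * g hom_smult)
qed

subsection \<open>Free algebras and presentations\<close>

lemma free_induct [case_names single add]:
  assumes "\<And>w c. P (Poly_Mapping.single w c)" "\<And>f g. P f \<Longrightarrow> P g \<Longrightarrow> P (f + g)"
  shows "P (f :: 'w \<Rightarrow>\<^sub>0 'k::monoid_add)"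
proof (induction f rule: update_induct)
  case const
  then show ?case
    \<comment> \<open>Zero is a single term with coefficient 0, at any key.\<close>
    using assms(1)[of undefined 0] by simp
next
  case (update f a b)
  \<comment> \<open>The key \<open>a\<close> is outside the support of \<open>f\<close>, so
    overwriting there amounts to adding.\<close>
  have "Poly_Mapping.update a b f = f + Poly_Mapping.single a b"
    using update(1) by (intro poly_mapping_eqI)
        (auto simp: lookup_update lookup_add lookup_single in_keys_iff when_def)
  then show ?case
    using assms update(3) by simp
qed

lemma free_alg_simps [simp]:
  "carrier free_alg = UNIV" "mult free_alg = (*)" "one free_alg = 1" "zero free_alg = 0"
  "add free_alg = (+)" "smult free_alg = (\<lambda>c f. cst c * f)"
  by (simp_all add: free_alg_def)

lemma cst_simps [simp]: "cst 0 = 0" "cst 1 = 1"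
  by (simp_all add: cst_def)

lemma cst_add: "cst (c + d) = cst c + cst d"
  by (simp add: cst_def single_add)

lemma cst_mult: "cst (c * d) = cst c * cst d"
  by (simp add: cst_def mult_single)

lemma cst_minus: "cst (- c) = - cst c"
  by (simp add: cst_def single_uminus)

lemma cst_mult_single: "cst c * Poly_Mapping.single w d = Poly_Mapping.single w (c * d)"
  by (simp add: cst_def mult_single)

lemma cst_central: "f * cst c = cst c * (f :: ('g, 'k::field) free)"
  by (induction f rule: free_induct) (simp_all add: cst_def mult_single algebra_simps)

lemma cst_left_commute: "f * (cst c * g) = cst c * (f * (g :: ('g, 'k::field) free))"
  by (metis cst_central mult.assoc)

lemma free_nc_algebra: "nc_algebra (free_alg :: ('k::field, ('g, 'k) free) module)"
proof -
  have "ring (free_alg :: ('k::field, ('g, 'k) free) module)"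
  proof (intro ringI abelian_groupI monoidI)
    fix f :: "('g, 'k) free"
    show "\<exists>g\<in>carrier free_alg. g \<oplus>\<^bsub>free_alg\<^esub> f = \<zero>\<^bsub>free_alg\<^esub>"
      by (rule bexI[of _ "- f"]) simp_all
  qed (simp_all add: algebra_simps)
  then show ?thesis
    by (intro nc_algebra.intro nc_algebra_axioms.intro)
      (simp_all add: cst_add cst_mult distrib_left distrib_right mult.assoc, rule cst_left_commute)
qed

text \<open>The rewrites state the facts of the locale in the type-class operations, so that
  computations in free algebras can use \<open>algebra_simps\<close>.\<close>

interpretation free_alg: nc_algebra free_alg
  rewrites "carrier free_alg = UNIV" and "mult free_alg = (*)" and "one free_alg = 1"
    and "zero free_alg = 0" and "add free_alg = (+)" and "smult free_alg = (\<lambda>c f. cst c * f)"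
  by (simp_all add: free_nc_algebra)

lemma free_alg_a_inv [simp]: "\<ominus>\<^bsub>free_alg\<^esub> f = - f"
  using free_alg.minus_equality[of "- f" f] by simp

lemma free_alg_minus [simp]: "f \<ominus>\<^bsub>free_alg\<^esub> g = f - g"
  by (simp add: a_minus_def)

lemma scalar_free_alg [simp]: "scalar free_alg c = cst c"
  by (simp add: scalar_def)

lemma letters_zero: "letters 0 = []"
  by (simp add: zero_fword_def)

section \<open>Linear extension from a basis, and evaluation of elements of a free algebra\<close>

context nc_algebra
begin

text \<open>Evaluation homomorphisms and skew derivations of a free algebra are both linear
  extensions of functions on words; their additive part is treated here once.\<close>

definition linear_extension :: "('w \<Rightarrow> 'a) \<Rightarrow> ('w \<Rightarrow>\<^sub>0 'k) \<Rightarrow> 'a" where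
  "linear_extension F f = (\<Oplus>w\<in>Poly_Mapping.keys f. Poly_Mapping.lookup f w \<odot> F w)"

context
  fixes F :: "'w \<Rightarrow> 'a"
  assumes F: "F w \<in> carrier A"
begin

text \<open>Cancellation can shrink the support of a sum; over a common finite superset of the
  supports, sums can be added term by term.\<close>

lemma linear_extension_superset:
  assumes "finite X" "Poly_Mapping.keys f \<subseteq> X"
  shows "linear_extension F f = (\<Oplus>w\<in>X. Poly_Mapping.lookup f w \<odot> F w)"
  unfolding linear_extension_def
  by (rule add.finprod_mono_neutral_cong_left) (use assms F in \<open>auto simp: in_keys_iff\<close>)

lemma linear_extension_closed [simp]: "linear_extension F f \<in> carrier A"
  using F by (simp add: linear_extension_def)

lemma linear_extension_add:
  "linear_extension F (f + g) = linear_extension F f \<oplus> linear_extension F g"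
proof -
  let ?X = "Poly_Mapping.keys f \<union> Poly_Mapping.keys g"
  have "linear_extension F (f + g) =
      (\<Oplus>w\<in>?X. Poly_Mapping.lookup f w \<odot> F w \<oplus> Poly_Mapping.lookup g w \<odot> F w)"
    using Poly_Mapping.keys_add[of f g] F
    by (subst linear_extension_superset[of ?X]) (auto simp: lookup_add smult_l_distr)
  also have "\<dots> = linear_extension F f \<oplus> linear_extension F g"
    using F by (subst (1 2) linear_extension_superset[of ?X]) (auto intro!: finsum_addf)
  finally show ?thesis .
qed

lemma linear_extension_single: "linear_extension F (Poly_Mapping.single w c) = c \<odot> F w"
  using F by (subst linear_extension_superset[of "{w}"]) auto

end

lemma linear_extension_cst_mult:
  fixes f :: "('g, 'k) free"
  assumes F: "\<And>w. F w \<in> carrier A"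
  shows "linear_extension F (cst c * f) = c \<odot> linear_extension F f"
  by (induction f rule: free_induct)
    (simp_all add: cst_mult_single linear_extension_single linear_extension_add F smult_assoc
      smult_r_distr distrib_left)

definition monomial :: "('g \<Rightarrow> 'a) \<Rightarrow> 'g fword \<Rightarrow> 'a" where
  "monomial G w = foldr (\<lambda>x r. G x \<otimes> r) (letters w) \<one>"

definition alg_eval :: "('g \<Rightarrow> 'a) \<Rightarrow> ('g, 'k) free \<Rightarrow> 'a" where
  "alg_eval G = linear_extension (monomial G)"

context
  fixes G :: "'g \<Rightarrow> 'a"
  assumes G: "G x \<in> carrier A"
begin

lemma monomial_closed [simp]: "monomial G w \<in> carrier A"
proof -
  have "foldr (\<lambda>x r. G x \<otimes> r) xs \<one> \<in> carrier A" for xs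
    using G by (induction xs) auto
  then show ?thesis
    by (simp add: monomial_def)
qed

lemma monomial_add: "monomial G (u + v) = monomial G u \<otimes> monomial G v"
proof -
  have *: "foldr (\<lambda>x r. G x \<otimes> r) xs \<one> \<in> carrier A" for xs
    using monomial_closed[of "Word xs"] by (simp add: monomial_def)
  have "foldr (\<lambda>x r. G x \<otimes> r) (xs @ ys) \<one> =
      foldr (\<lambda>x r. G x \<otimes> r) xs \<one> \<otimes> foldr (\<lambda>x r. G x \<otimes> r) ys \<one>" for xs ys
    using G * by (induction xs) (auto simp: m_assoc simp del: foldr_append)
  then show ?thesis
    by (simp add: monomial_def plus_fword_def del: foldr_append)
qed

lemma alg_eval_single: "alg_eval G (Poly_Mapping.single w c) = c \<odot> monomial G w"
  by (simp add: alg_eval_def linear_extension_single)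

lemma alg_eval_add: "alg_eval G (f + g) = alg_eval G f \<oplus> alg_eval G g"
  by (simp add: alg_eval_def linear_extension_add)

lemma alg_eval_closed [simp]: "alg_eval G f \<in> carrier A"
  by (simp add: alg_eval_def)

text \<open>Both sides are additive in each factor, so it is enough to multiply two words with
  coefficients, where concatenation becomes the product in \<open>A\<close>.\<close>

lemma alg_eval_mult: "alg_eval G (f * g) = alg_eval G f \<otimes> alg_eval G g"
proof (induction f rule: free_induct)
  case (single u c)
  show ?case
  proof (induction g rule: free_induct)
    case (single v d)
    show ?case
      by (simp add: mult_single alg_eval_single monomial_add smult_mult_left smult_mult_right
          mult.commute[of c] flip: smult_assoc)
  qed (simp add: distrib_left alg_eval_add r_distr)
qed (simp add: distrib_right alg_eval_add l_distr)

lemma alg_eval_hom: "alg_eval G \<in> alg_hom free_alg A"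
proof (rule alg_homI)
  show "alg_eval G \<one>\<^bsub>free_alg\<^esub> = \<one>"
    using alg_eval_single[of 0 1] by (simp add: monomial_def letters_zero)
next
  fix c f
  show "alg_eval G (c \<odot>\<^bsub>free_alg\<^esub> f) = c \<odot> alg_eval G f"
    by (simp add: alg_eval_def linear_extension_cst_mult)
qed (simp_all add: alg_eval_mult alg_eval_add)

lemma alg_eval_gen: "alg_eval G (gen x) = G x"
  using G by (simp add: gen_def alg_eval_single monomial_def)

end

end

lemma free_alg_hom:
  assumes "s \<in> alg_hom free_alg free_alg"
  shows "s (f + g) = s f + s g" "s (f * g) = s f * s g" "s 1 = 1" "s 0 = 0" "s (- f) = - s f"
    "s (f - g) = s f - s g" "s (f ^ n) = s f ^ n" "s (cst c) = cst c"
proof -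
  interpret s: alg_morph free_alg free_alg s
    using assms by (intro alg_morph.intro alg_morph_axioms.intro free_nc_algebra)
  show "s (f + g) = s f + s g" "s (f * g) = s f * s g" "s 1 = 1" "s 0 = 0" "s (- f) = - s f"
    "s (f - g) = s f - s g" "s (cst c) = cst c"
    using s.hom_add[of f g] s.hom_mult[of f g] s.hom_one s.hom_zero s.hom_a_inv[of f]
      s.hom_minus[of f g] s.hom_scalar[of c] by simp_all
  show "s (f ^ n) = s f ^ n"
    using s.hom_mult s.hom_one by (induction n) simp_all
qed

lemma free_word_induct [case_names gen cst add mult]:
  assumes "\<And>x. P (gen x)" "\<And>c. P (cst c)" "\<And>f g. P f \<Longrightarrow> P g \<Longrightarrow> P (f + g)"
    "\<And>f g. P f \<Longrightarrow> P g \<Longrightarrow> P (f * g)"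
  shows "P (f :: ('g, 'k::field) free)"
proof (induction f rule: free_induct)
  case (single w c)
  have "P (Poly_Mapping.single (Word xs) 1)" for xs
  proof (induction xs)
    case Nil
    then show ?case
      using assms(2)[of 1] by (simp add: cst_def zero_fword_def)
  next
    case (Cons x xs)
    have "Poly_Mapping.single (Word (x # xs)) 1 = gen x * Poly_Mapping.single (Word xs) (1::'k)"
      by (simp add: gen_def mult_single plus_fword_def)
    then show ?case
      using assms(1,4) Cons by simp
  qed
  from assms(4)[OF assms(2)[of c] this[of "letters w"]] show ?case
    by (simp add: cst_mult_single)
qed (rule assms(3))

text \<open>On a word, the product rule leaves no choice once the values \<open>D x\<close> on the letters are given.\<close>

definition free_skew_derivation ::
  "(('g, 'k) free \<Rightarrow> ('g, 'k) free) \<Rightarrow> ('g \<Rightarrow> ('g, 'k) free) \<Rightarrow>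
    ('g, 'k::field) free \<Rightarrow> ('g, 'k) free" where
  "free_skew_derivation s D = nc_algebra.linear_extension free_alg (\<lambda>w. rec_list 0
    (\<lambda>x xs r. D x * Poly_Mapping.single (Word xs) 1 + s (gen x) * r) (letters w))"

lemma free_skew_derivation:
  fixes D :: "'g \<Rightarrow> ('g, 'k::field) free"
  assumes s: "s \<in> alg_hom free_alg free_alg"
  defines "\<delta> \<equiv> free_skew_derivation s D"
  shows "\<delta> (f + g) = \<delta> f + \<delta> g" "\<delta> (cst c * f) = cst c * \<delta> f"
    "\<delta> (f * g) = \<delta> f * g + s f * \<delta> g" "\<delta> (gen x) = D x"
    "\<delta> (cst c) = 0" "\<delta> (f - g) = \<delta> f - \<delta> g"
proof -
  define m where "m xs = Poly_Mapping.single (Word xs) (1::'k)" for xs :: "'g list"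
  have m: "m (x # xs) = gen x * m xs" "m [] = 1" "m (xs @ ys) = m xs * m ys" for x xs ys
    by (simp_all add: m_def gen_def mult_single plus_fword_def flip: zero_fword_def)
  define d where "d = rec_list 0 (\<lambda>x xs r. D x * m xs + s (gen x) * r)"
  have d: "d [] = 0" "d (x # xs) = D x * m xs + s (gen x) * d xs" for x xs
    by (simp_all add: d_def)
  \<comment> \<open>The twisted product rule for concatenated words. The general rule follows by
    bilinearity, because \<open>s\<close> fixes the constants and these are central.\<close>
  have d_append: "d (xs @ ys) = d xs * m ys + s (m xs) * d ys" for xs ys
    by (induction xs) (simp_all add: d m free_alg_hom[OF s] algebra_simps)
  have \<delta>_def: "\<delta> = free_alg.linear_extension (\<lambda>w. d (letters w))"
    by (simp add: assms(2) free_skew_derivation_def d_def m_def)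
  have single: "\<delta> (Poly_Mapping.single w c) = cst c * d (letters w)" for w c
    by (simp add: \<delta>_def free_alg.linear_extension_single)
  have add: "\<delta> (f + g) = \<delta> f + \<delta> g" for f g
    by (simp add: \<delta>_def free_alg.linear_extension_add)
  then show "\<delta> (f + g) = \<delta> f + \<delta> g" .
  have diff: "\<delta> (f - g) = \<delta> f - \<delta> g" for f g
    using add[of "f - g" g] by simp
  then show "\<delta> (f - g) = \<delta> f - \<delta> g" .
  show "\<delta> (cst c) = 0"
    using single[of 0 c] by (simp add: cst_def d letters_zero)
  show "\<delta> (cst c * f) = cst c * \<delta> f"
    by (simp add: \<delta>_def free_alg.linear_extension_cst_mult)
  show "\<delta> (gen x) = D x"
    by (simp add: gen_def single d m)
  have m': "Poly_Mapping.single w c = cst c * m (letters w)" for w c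
    by (simp add: m_def cst_mult_single)
  show "\<delta> (f * g) = \<delta> f * g + s f * \<delta> g"
  proof (induction f rule: free_induct)
    case (single u c)
    show ?case
    proof (induction g rule: free_induct)
      case (single v e)
      have "\<delta> (Poly_Mapping.single u c * Poly_Mapping.single v e) =
          cst (c * e) * (d (letters u) * m (letters v) + s (m (letters u)) * d (letters v))"
        by (simp add: mult_single \<open>\<And>w c. \<delta> (Poly_Mapping.single w c) = _\<close> plus_fword_def d_append)
      also have "\<dots> = cst c * d (letters u) * (cst e * m (letters v)) +
          cst c * s (m (letters u)) * (cst e * d (letters v))"
        by (simp add: cst_mult algebra_simps cst_left_commute[of "d (letters u)" e]
              cst_left_commute[of "s (m (letters u))" e])
      finally show ?case
        by (simp only: \<open>\<And>w c. \<delta> (Poly_Mapping.single w c) = _\<close>)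
          (simp add: m' free_alg_hom[OF s])
    qed (simp add: distrib_left add)
  qed (simp add: distrib_right add free_alg_hom[OF s] algebra_simps)
qed

section \<open>Computing in presented algebras through representatives\<close>

definition presented_proj :: "('g, 'k::field) free set \<Rightarrow> ('g, 'k) free \<Rightarrow> ('g, 'k) free set" where
  "presented_proj S f = (Idl\<^bsub>free_alg\<^esub> S) +>\<^bsub>free_alg\<^esub> f"

lemma free_alg_genideal: "ideal (Idl\<^bsub>free_alg\<^esub> S) free_alg"
  by (rule free_alg.genideal_ideal) simp

lemma genideal_self_free: "f \<in> S \<Longrightarrow> f \<in> Idl\<^bsub>free_alg\<^esub> S"
  using free_alg.genideal_self[of S] by auto

lemma presented_proj_morph: "alg_morph free_alg (presented_alg S) (presented_proj S)"
proof -
  have "presented_proj S = (+>\<^bsub>free_alg\<^esub>) (Idl\<^bsub>free_alg\<^esub> S)"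
    by (simp add: presented_proj_def fun_eq_iff)
  then show ?thesis
    using nc_algebra.alg_quot_proj_morph[OF free_nc_algebra free_alg_genideal]
    by (simp add: presented_alg_def)
qed

lemma presented_nc_algebra: "nc_algebra (presented_alg S)"
  using presented_proj_morph alg_morph.axioms(2) by blast

lemma presented_carrier: "carrier (presented_alg S) = range (presented_proj S)"
  using nc_algebra.alg_quot_carrier[OF free_nc_algebra, of "Idl\<^bsub>free_alg\<^esub> S"]
  by (simp add: presented_alg_def presented_proj_def)

lemma presented_proj_eq_zero_iff:
  "presented_proj S f = \<zero>\<^bsub>presented_alg S\<^esub> \<longleftrightarrow> f \<in> Idl\<^bsub>free_alg\<^esub> S"
  using nc_algebra.alg_quot_proj_eq_zero_iff[OF free_nc_algebra free_alg_genideal]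
  by (simp add: presented_alg_def presented_proj_def)

lemma presented_proj_eq_iff:
  "presented_proj S f = presented_proj S g \<longleftrightarrow> f - g \<in> Idl\<^bsub>free_alg\<^esub> S"
  using free_alg.quotient_eq_iff_same_a_r_cos[OF free_alg_genideal, of f g S]
  by (simp add: presented_proj_def)

lemma presented_proj_closed [simp]: "presented_proj S f \<in> carrier (presented_alg S)"
  by (simp add: presented_carrier)

text \<open>Read from left to right, these collapse an expression in the presented algebra to the
  projection of one expression in the free algebra.\<close>

lemma presented_proj_ops:
  "presented_proj S f \<oplus>\<^bsub>presented_alg S\<^esub> presented_proj S g = presented_proj S (f + g)"
  "presented_proj S f \<otimes>\<^bsub>presented_alg S\<^esub> presented_proj S g = presented_proj S (f * g)"
  "presented_proj S f \<ominus>\<^bsub>presented_alg S\<^esub> presented_proj S g = presented_proj S (f - g)"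
  "\<ominus>\<^bsub>presented_alg S\<^esub> presented_proj S f = presented_proj S (- f)"
  "c \<odot>\<^bsub>presented_alg S\<^esub> presented_proj S f = presented_proj S (cst c * f)"
  "scalar (presented_alg S) c = presented_proj S (cst c)"
  "\<one>\<^bsub>presented_alg S\<^esub> = presented_proj S 1"
  "\<zero>\<^bsub>presented_alg S\<^esub> = presented_proj S 0"
proof -
  interpret p: alg_morph free_alg "presented_alg S" "presented_proj S"
    by (rule presented_proj_morph)
  show "presented_proj S f \<oplus>\<^bsub>presented_alg S\<^esub> presented_proj S g = presented_proj S (f + g)"
    "presented_proj S f \<otimes>\<^bsub>presented_alg S\<^esub> presented_proj S g = presented_proj S (f * g)"
    "presented_proj S f \<ominus>\<^bsub>presented_alg S\<^esub> presented_proj S g = presented_proj S (f - g)"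
    "\<ominus>\<^bsub>presented_alg S\<^esub> presented_proj S f = presented_proj S (- f)"
    "c \<odot>\<^bsub>presented_alg S\<^esub> presented_proj S f = presented_proj S (cst c * f)"
    "scalar (presented_alg S) c = presented_proj S (cst c)"
    "\<one>\<^bsub>presented_alg S\<^esub> = presented_proj S 1"
    "\<zero>\<^bsub>presented_alg S\<^esub> = presented_proj S 0"
    using p.hom_add[of f g] p.hom_mult[of f g] p.hom_minus[of f g] p.hom_a_inv[of f]
      p.hom_smult[of f c] p.hom_scalar[of c] p.hom_one p.hom_zero by simp_all
qed

text \<open>Permits replacing a subexpression modulo the relations while staying in the free
  algebra.\<close>

lemma presented_proj_cong:
  assumes "presented_proj S f = presented_proj S f'" "presented_proj S g = presented_proj S g'"
  shows "presented_proj S (f + g) = presented_proj S (f' + g')"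
    and "presented_proj S (f * g) = presented_proj S (f' * g')"
  using assms by (simp_all flip: presented_proj_ops)

lemma genideal_free_closed:
  assumes "f \<in> Idl\<^bsub>free_alg\<^esub> S"
  shows "g * f \<in> Idl\<^bsub>free_alg\<^esub> S" "f * g \<in> Idl\<^bsub>free_alg\<^esub> S" "- f \<in> Idl\<^bsub>free_alg\<^esub> S"
    and "g \<in> Idl\<^bsub>free_alg\<^esub> S \<Longrightarrow> f + g \<in> Idl\<^bsub>free_alg\<^esub> S"
    and "g \<in> Idl\<^bsub>free_alg\<^esub> S \<Longrightarrow> f - g \<in> Idl\<^bsub>free_alg\<^esub> S"
  using ideal.I_l_closed[OF free_alg_genideal assms, of g]
    ideal.I_r_closed[OF free_alg_genideal assms, of g]
    additive_subgroup.a_closed[OF ideal.axioms(1)[OF free_alg_genideal], of f S]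
    additive_subgroup.a_inv_closed[OF ideal.axioms(1)[OF free_alg_genideal], of _ S] assms
  by (simp_all add: diff_conv_add_uminus del: add_uminus_conv_diff)

lemma pgen_eq: "pgen S x = presented_proj S (gen x)"
  by (simp add: pgen_def presented_proj_def)

text \<open>The universal property of a presentation: the kernel of \<open>h\<close> is an ideal, so
  it contains the whole ideal generated by \<open>S\<close> as soon as it contains
  \<open>S\<close>.\<close>

lemma presented_lift:
  assumes "alg_morph free_alg B h" "\<And>f. f \<in> S \<Longrightarrow> h f = \<zero>\<^bsub>B\<^esub>"
  obtains g where "g \<in> alg_hom (presented_alg S) B" "\<And>f. g (presented_proj S f) = h f"
proof -
  interpret h: alg_morph free_alg B h by fact
  let ?I = "Idl\<^bsub>free_alg\<^esub> S"
  have kernel: "h f = \<zero>\<^bsub>B\<^esub>" if "f \<in> ?I" for f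
    by (rule h.genideal_subset_kernel[OF _ assms(2) that]) simp_all
  show ?thesis
  proof (rule h.alg_quot_lift[OF free_alg_genideal kernel])
    fix g assume "g \<in> alg_hom (alg_quot free_alg ?I) B"
      and "\<And>f. f \<in> carrier free_alg \<Longrightarrow> g (?I +>\<^bsub>free_alg\<^esub> f) = h f"
    then show thesis
      by (intro that[of g]) (simp_all add: presented_alg_def presented_proj_def)
  qed
qed

subsection \<open>Ore extensions\<close>

lemma skew_derivationD:
  assumes "\<delta> \<in> skew_derivation R \<sigma>"
  shows "x \<in> carrier R \<Longrightarrow> \<delta> x \<in> carrier R"
    and "x \<in> carrier R \<Longrightarrow> z \<in> carrier R \<Longrightarrow> \<delta> (x \<oplus>\<^bsub>R\<^esub> z) = \<delta> x \<oplus>\<^bsub>R\<^esub> \<delta> z"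
    and "x \<in> carrier R \<Longrightarrow> \<delta> (c \<odot>\<^bsub>R\<^esub> x) = c \<odot>\<^bsub>R\<^esub> \<delta> x"
    and "x \<in> carrier R \<Longrightarrow> z \<in> carrier R \<Longrightarrow>
      \<delta> (x \<otimes>\<^bsub>R\<^esub> z) = (\<delta> x \<otimes>\<^bsub>R\<^esub> z) \<oplus>\<^bsub>R\<^esub> (\<sigma> x \<otimes>\<^bsub>R\<^esub> \<delta> z)"
  using assms by (auto simp: skew_derivation_def)

locale ore_data = nc_algebra R for R :: "('k::field, 'a) module" (structure) +
  fixes \<sigma> \<delta> :: "'a \<Rightarrow> 'a"
  assumes \<sigma>: "\<sigma> \<in> alg_hom R R" and \<delta>: "\<delta> \<in> skew_derivation R \<sigma>"
begin

lemmas \<sigma>_simps = alg_homD[OF \<sigma>] and \<delta>_simps = skew_derivationD[OF \<delta>]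

lemma \<sigma>_zero [simp]: "\<sigma> \<zero> = \<zero>"
  using \<sigma>_simps(5)[of \<zero> 0] \<sigma>_simps(1)[of \<zero>] by simp

lemma \<delta>_zero [simp]: "\<delta> \<zero> = \<zero>"
  using \<delta>_simps(3)[of \<zero> 0] \<delta>_simps(1)[of \<zero>] by simp

lemma \<delta>_one [simp]: "\<delta> \<one> = \<zero>"
  using \<delta>_simps(4)[of \<one> \<one>] \<delta>_simps(1)[of \<one>] \<sigma>_simps(4) by (simp add: add.l_cancel_one')

abbreviation mon :: "'a \<Rightarrow> nat \<Rightarrow> nat \<Rightarrow> 'a" where
  "mon r k \<equiv> (\<lambda>i. if i = k then r else \<zero>)"

abbreviation D :: "(nat \<Rightarrow> 'a) \<Rightarrow> nat \<Rightarrow> 'a" where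
  "D \<equiv> ore_shift R \<delta> \<sigma>"

lemma up_closed [simp]: "p \<in> up R \<Longrightarrow> p n \<in> carrier R"
  by (rule mem_upD)

lemma up_memI: "(\<And>n. p n \<in> carrier R) \<Longrightarrow> (\<And>i. N < i \<Longrightarrow> p i = \<zero>) \<Longrightarrow> p \<in> up R"
  by (intro mem_upI exI[of _ N] bound.intro)

lemma up_boundE:
  assumes "p \<in> up R"
  obtains N where "\<And>i. N < i \<Longrightarrow> p i = \<zero>"
  using bound_upD[OF assms] bound.bound that by metis

lemma mon_closed [simp]: "r \<in> carrier R \<Longrightarrow> mon r k \<in> up R"
  by (rule up_memI[of _ k]) auto

lemma up_finite_support:
  assumes "p \<in> up R"
  shows "finite {i. p i \<noteq> \<zero>}"
proof -
  obtain N where "\<And>i. N < i \<Longrightarrow> p i = \<zero>"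
    using up_boundE[OF assms] by blast
  then have "{i. p i \<noteq> \<zero>} \<subseteq> {..N}"
    by (metis (mono_tags, lifting) atMost_iff linorder_not_le mem_Collect_eq subsetI)
  then show ?thesis
    by (rule finite_subset) simp
qed

text \<open>Identities that are additive in \<open>p\<close> need only be verified for monomials
  \<open>r d^k\<close>; the leading coefficient is split off repeatedly.\<close>

lemma up_induct [consumes 1, case_names mon add]:
  assumes "p \<in> up R" "\<And>r k. r \<in> carrier R \<Longrightarrow> P (mon r k)"
    and "\<And>p q. p \<in> up R \<Longrightarrow> q \<in> up R \<Longrightarrow> P p \<Longrightarrow> P q \<Longrightarrow> P (\<lambda>n. p n \<oplus> q n)"
  shows "P p"
proof -
  \<comment> \<open>Here \<open>N\<close> bounds the degree strictly, so \<open>N = 0\<close> means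
    the zero sequence and clearing the coefficient at \<open>N\<close> lowers the bound. The bound
    obtained for \<open>p\<close> below is the non-strict one, used at \<open>Suc N\<close>.\<close>
  have "P q" if "q \<in> up R" "\<And>i. N \<le> i \<Longrightarrow> q i = \<zero>" for q N
    using that
  proof (induction N arbitrary: q)
    case 0
    then have "q = mon \<zero> 0"
      by (auto simp: fun_eq_iff)
    then show ?case
      using assms(2)[of \<zero> 0] by (simp only: zero_closed)
  next
    case (Suc N)
    let ?q = "q(N := \<zero>)"
    have q: "?q \<in> up R"
      using Suc.prems by (intro up_memI[of _ N]) auto
    have "P ?q"
      using Suc.prems(2) by (intro Suc.IH q) (auto simp: Suc_le_eq)
    from assms(3)[OF q mon_closed this assms(2)]
    have "P (\<lambda>n. ?q n \<oplus> mon (q N) N n)"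
      using Suc.prems(1) by (simp only: up_closed)
    moreover have "q = (\<lambda>n. ?q n \<oplus> mon (q N) N n)"
      using Suc.prems(1) by (auto simp: fun_eq_iff)
    ultimately show ?case
      by (rule ssubst[rotated])
  qed
  moreover obtain N where "\<And>i. N < i \<Longrightarrow> p i = \<zero>"
    using up_boundE[OF assms(1)] by blast
  ultimately show ?thesis
    using assms(1) by (metis Suc_le_eq)
qed

text \<open>Left multiplication by \<open>d\<close> raises the degree by at most one, hence the
  bound \<open>Suc N\<close>.\<close>

lemma D_closed [simp]:
  assumes "q \<in> up R"
  shows "D q \<in> up R"
proof -
  obtain N where "\<And>i. N < i \<Longrightarrow> q i = \<zero>"
    using up_boundE[OF assms] by blast
  then show ?thesis
    using assms
    by (intro up_memI[of _ "Suc N"]) (simp_all add: ore_shift_def \<sigma>_simps \<delta>_simps split: nat.split)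
qed

lemma D_pow_closed [simp]: "q \<in> up R \<Longrightarrow> (D ^^ i) q \<in> up R"
  by (induction i) auto

lemma D_add: "p \<in> up R \<Longrightarrow> q \<in> up R \<Longrightarrow> D (\<lambda>n. p n \<oplus> q n) = (\<lambda>n. D p n \<oplus> D q n)"
  by (auto simp: ore_shift_def fun_eq_iff \<sigma>_simps \<delta>_simps a_ac split: nat.split)

text \<open>The rule \<open>d r = \<sigma>(r) d + \<delta>(r)\<close> applied to a whole sequence.
  Through it the multiplicativity of \<open>\<sigma>\<close> and the product rule of
  \<open>\<delta>\<close> enter associativity.\<close>

lemma D_scale:
  "r \<in> carrier R \<Longrightarrow> q \<in> up R \<Longrightarrow> D (\<lambda>n. r \<otimes> q n) = (\<lambda>n. (\<sigma> r \<otimes> D q n) \<oplus> (\<delta> r \<otimes> q n))"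
  by (auto simp: ore_shift_def fun_eq_iff \<sigma>_simps \<delta>_simps a_ac r_distr split: nat.split)

lemma D_mon: "r \<in> carrier R \<Longrightarrow> D (mon r k) = (\<lambda>n. mon (\<sigma> r) (Suc k) n \<oplus> mon (\<delta> r) k n)"
  by (auto simp: ore_shift_def fun_eq_iff \<sigma>_simps \<delta>_simps split: nat.split)

lemma D_pow_add:
  "p \<in> up R \<Longrightarrow> q \<in> up R \<Longrightarrow> (D ^^ k) (\<lambda>n. p n \<oplus> q n) = (\<lambda>n. (D ^^ k) p n \<oplus> (D ^^ k) q n)"
  by (induction k) (simp_all add: D_add)

lemma D_pow_smult: "q \<in> up R \<Longrightarrow> (D ^^ k) (\<lambda>n. c \<odot> q n) = (\<lambda>n. c \<odot> (D ^^ k) q n)"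
proof (induction k)
  case (Suc k)
  have "D (\<lambda>n. c \<odot> q n) = (\<lambda>n. c \<odot> D q n)" if "q \<in> up R" for q
    using that by (auto simp: ore_shift_def fun_eq_iff \<sigma>_simps \<delta>_simps smult_r_distr
        split: nat.split)
  with Suc show ?case
    by simp
qed simp

text \<open>Powers of \<open>d\<close> multiply as expected because \<open>\<sigma>\<close> fixes 1
  and \<open>\<delta>\<close> kills it.\<close>

lemma D_pow_mon_one: "(D ^^ k) (mon \<one> l) = mon \<one> (k + l)"
proof (induction k)
  case (Suc k)
  then show ?case
    by (simp add: D_mon) (auto simp: fun_eq_iff \<sigma>_simps)
qed simp

lemma ore_mult_superset:
  assumes "p \<in> up R" "q \<in> up R" "finite X" "{i. p i \<noteq> \<zero>} \<subseteq> X"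
  shows "ore_mult R \<delta> \<sigma> p q n = (\<Oplus>i\<in>X. p i \<otimes> (D ^^ i) q n)"
  unfolding ore_mult_def
  by (rule add.finprod_mono_neutral_cong_left) (use assms in auto)

lemma ore_mult_add_left:
  assumes "p \<in> up R" "p' \<in> up R" "q \<in> up R"
  shows "ore_mult R \<delta> \<sigma> (\<lambda>n. p n \<oplus> p' n) q = (\<lambda>n. ore_mult R \<delta> \<sigma> p q n \<oplus> ore_mult R \<delta> \<sigma> p' q n)"
proof
  fix n
  let ?X = "{i. p i \<noteq> \<zero>} \<union> {i. p' i \<noteq> \<zero>}"
  have fin: "finite ?X"
    using assms by (simp add: up_finite_support)
  have "ore_mult R \<delta> \<sigma> (\<lambda>n. p n \<oplus> p' n) q n = (\<Oplus>i\<in>?X. (p i \<oplus> p' i) \<otimes> (D ^^ i) q n)"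
    by (rule ore_mult_superset) (use assms fin in \<open>auto simp: up_add_closed\<close>)
  also have "\<dots> = (\<Oplus>i\<in>?X. p i \<otimes> (D ^^ i) q n \<oplus> p' i \<otimes> (D ^^ i) q n)"
    using assms by (intro finsum_cong') (auto simp: l_distr)
  also have "\<dots> = (\<Oplus>i\<in>?X. p i \<otimes> (D ^^ i) q n) \<oplus> (\<Oplus>i\<in>?X. p' i \<otimes> (D ^^ i) q n)"
    using assms by (intro finsum_addf) auto
  also have "\<dots> = ore_mult R \<delta> \<sigma> p q n \<oplus> ore_mult R \<delta> \<sigma> p' q n"
    using ore_mult_superset[OF assms(1,3) fin] ore_mult_superset[OF assms(2,3) fin] by simp
  finally show "ore_mult R \<delta> \<sigma> (\<lambda>n. p n \<oplus> p' n) q n = \<dots>" .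
qed

lemma ore_mult_mon:
  assumes "r \<in> carrier R" "q \<in> up R"
  shows "ore_mult R \<delta> \<sigma> (mon r k) q = (\<lambda>n. r \<otimes> (D ^^ k) q n)"
proof
  fix n
  have "ore_mult R \<delta> \<sigma> (mon r k) q n = (\<Oplus>i\<in>{k}. mon r k i \<otimes> (D ^^ i) q n)"
    using assms by (intro ore_mult_superset) auto
  then show "ore_mult R \<delta> \<sigma> (mon r k) q n = r \<otimes> (D ^^ k) q n"
    using assms by simp
qed

lemma ore_mult_closed [simp]:
  assumes "p \<in> up R" "q \<in> up R"
  shows "ore_mult R \<delta> \<sigma> p q \<in> up R"
  using assms by (induction p rule: up_induct)
    (simp_all add: ore_mult_mon ore_mult_add_left up_add_closed up_smult_closed)

lemma ore_mult_scale_left: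
  assumes "r \<in> carrier R" "p \<in> up R" "q \<in> up R"
  shows "ore_mult R \<delta> \<sigma> (\<lambda>n. r \<otimes> p n) q = (\<lambda>n. r \<otimes> ore_mult R \<delta> \<sigma> p q n)"
  using assms(2)
proof (induction p rule: up_induct)
  case (mon s k)
  have "(\<lambda>n. r \<otimes> mon s k n) = mon (r \<otimes> s) k"
    using assms(1) by auto
  then show ?case
    using mon assms by (simp add: ore_mult_mon m_assoc)
next
  case (add p p')
  then show ?case
    using assms by (simp add: r_distr ore_mult_add_left up_smult_closed)
qed

text \<open>Associativity with first factor \<open>d\<close>. For \<open>p = r d^k\<close> both
  sides are \<open>\<sigma>(r) D^(k+1) q + \<delta>(r) D^k q\<close>.\<close>

lemma D_ore_mult:
  assumes "p \<in> up R" "q \<in> up R"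
  shows "D (ore_mult R \<delta> \<sigma> p q) = ore_mult R \<delta> \<sigma> (D p) q"
  using assms(1)
proof (induction p rule: up_induct)
  case (mon r k)
  then show ?case
    using assms(2) by (simp add: ore_mult_mon D_scale D_mon ore_mult_add_left \<sigma>_simps \<delta>_simps)
next
  case (add p p')
  then show ?case
    using assms(2) by (simp add: ore_mult_add_left D_add)
qed

lemma D_pow_ore_mult:
  "p \<in> up R \<Longrightarrow> q \<in> up R \<Longrightarrow> (D ^^ k) (ore_mult R \<delta> \<sigma> p q) = ore_mult R \<delta> \<sigma> ((D ^^ k) p) q"
  by (induction k) (simp_all add: D_ore_mult)

text \<open>For \<open>p = r d^k\<close> the coefficient \<open>r\<close> passes by left linearity
  of the product, and \<open>d^k\<close> by iterating \<open>D_ore_mult\<close>.\<close>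

lemma ore_mult_assoc:
  assumes "p \<in> up R" "q \<in> up R" "s \<in> up R"
  shows "ore_mult R \<delta> \<sigma> (ore_mult R \<delta> \<sigma> p q) s = ore_mult R \<delta> \<sigma> p (ore_mult R \<delta> \<sigma> q s)"
  using assms(1)
proof (induction p rule: up_induct)
  case (mon r k)
  then show ?case
    using assms(2,3) by (simp add: ore_mult_mon ore_mult_scale_left D_pow_ore_mult)
next
  case (add p p')
  then show ?case
    using assms(2,3) by (simp add: ore_mult_add_left)
qed

lemma ore_mult_add_right:
  assumes "p \<in> up R" "q \<in> up R" "q' \<in> up R"
  shows "ore_mult R \<delta> \<sigma> p (\<lambda>n. q n \<oplus> q' n) = (\<lambda>n. ore_mult R \<delta> \<sigma> p q n \<oplus> ore_mult R \<delta> \<sigma> p q' n)"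
  using assms(1)
proof (induction p rule: up_induct)
  case (mon r k)
  then show ?case
    using assms(2,3) by (simp add: ore_mult_mon D_pow_add up_add_closed r_distr)
next
  case (add p p')
  then show ?case
    using assms(2,3) by (simp add: ore_mult_add_left up_add_closed a_ac)
qed

lemma ore_mult_one_left: "q \<in> up R \<Longrightarrow> ore_mult R \<delta> \<sigma> (mon \<one> 0) q = q"
  by (simp add: ore_mult_mon)

lemma ore_mult_one_right: "p \<in> up R \<Longrightarrow> ore_mult R \<delta> \<sigma> p (mon \<one> 0) = p"
  by (induction p rule: up_induct)
    (auto simp: ore_mult_mon ore_mult_add_left D_pow_mon_one)

lemma up_module_smult_closed:
  assumes "p \<in> up R"
  shows "(\<lambda>n. c \<odot> p n) \<in> up R"
proof -
  obtain N where "\<And>i. N < i \<Longrightarrow> p i = \<zero>"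
    using up_boundE[OF assms] by blast
  then show ?thesis
    using assms by (intro up_memI[of _ N]) simp_all
qed

text \<open>Scalars pass through the left factor because \<open>\<sigma>\<close> and
  \<open>\<delta>\<close> are linear, so that \<open>D\<close> commutes with scalars.\<close>

lemma ore_mult_smult_right:
  assumes "p \<in> up R" "q \<in> up R"
  shows "ore_mult R \<delta> \<sigma> p (\<lambda>n. c \<odot> q n) = (\<lambda>n. c \<odot> ore_mult R \<delta> \<sigma> p q n)"
  using assms(1)
proof (induction p rule: up_induct)
  case (mon r k)
  then show ?case
    using assms(2) by (simp add: ore_mult_mon up_module_smult_closed D_pow_smult smult_mult_right)
next
  case (add p p')
  then show ?case
    using assms(2) by (simp add: ore_mult_add_left up_module_smult_closed smult_r_distr)
qed

lemma ore_mult_smult_left: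
  assumes "p \<in> up R" "q \<in> up R"
  shows "ore_mult R \<delta> \<sigma> (\<lambda>n. c \<odot> p n) q = (\<lambda>n. c \<odot> ore_mult R \<delta> \<sigma> p q n)"
  using ore_mult_scale_left[of "scalar R c" p q] assms by (simp add: scalar_mult)

abbreviation S :: "('k, nat \<Rightarrow> 'a) module" where
  "S \<equiv> ore_ext R \<delta> \<sigma>"

lemma ore_ext_simps [simp]:
  "carrier S = up R" "mult S = ore_mult R \<delta> \<sigma>" "one S = mon \<one> 0" "zero S = (\<lambda>_. \<zero>)"
  "smult S = (\<lambda>c p n. c \<odot> p n)"
  by (simp_all add: ore_ext_def UP_def)

text \<open>Addition in \<open>UP\<close> is a restricted function, hence the two membership
  hypotheses.\<close>

lemma ore_ext_add [simp]: "p \<in> up R \<Longrightarrow> q \<in> up R \<Longrightarrow> p \<oplus>\<^bsub>S\<^esub> q = (\<lambda>n. p n \<oplus> q n)"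
  by (simp add: ore_ext_def UP_def)

lemma ore_var_eq: "ore_var R = mon \<one> 1"
  by (simp add: ore_var_def UP_def)

lemma ore_ext_nc_algebra: "nc_algebra S"
proof -
  have "ring S"
  proof (intro ringI abelian_groupI monoidI)
    fix p assume p: "p \<in> carrier S"
    show "\<exists>q\<in>carrier S. q \<oplus>\<^bsub>S\<^esub> p = \<zero>\<^bsub>S\<^esub>"
      using p up_a_inv_closed[of p] by (intro bexI[of _ "\<lambda>n. \<ominus> p n"]) (auto simp: l_neg)
  qed (simp_all add: up_add_closed a_ac ore_mult_assoc ore_mult_one_left ore_mult_one_right
      ore_mult_add_left ore_mult_add_right up_memI)
  then show ?thesis
    by (intro nc_algebra.intro nc_algebra_axioms.intro)
      (simp_all add: up_module_smult_closed smult_l_distr smult_r_distr smult_assoc up_add_closed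
        ore_mult_smult_left ore_mult_smult_right)
qed

definition const :: "'a \<Rightarrow> nat \<Rightarrow> 'a" where
  "const r = mon r 0"

lemma const_hom: "const \<in> alg_hom R S"
  by (rule alg_homI) (auto simp: const_def ore_mult_mon)

lemma ore_var_closed [simp]: "ore_var R \<in> up R"
  by (simp add: ore_var_eq)

lemma ore_var_const:
  assumes "x \<in> carrier R"
  shows "ore_var R \<otimes>\<^bsub>S\<^esub> const x = const (\<sigma> x) \<otimes>\<^bsub>S\<^esub> ore_var R \<oplus>\<^bsub>S\<^esub> const (\<delta> x)"
  using assms by (auto simp: ore_var_eq const_def ore_mult_mon D_mon \<sigma>_simps \<delta>_simps
      up_smult_closed)

text \<open>From \<open>r d^(k+1) = (r d^k) d\<close>, coefficients and variable generate the Ore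
  extension; homomorphisms out of it can thus be compared there.\<close>

lemma ore_induct [consumes 1, case_names const var add mult]:
  assumes "p \<in> up R" "\<And>r. r \<in> carrier R \<Longrightarrow> P (const r)" "P (ore_var R)"
    and add: "\<And>p q. p \<in> up R \<Longrightarrow> q \<in> up R \<Longrightarrow> P p \<Longrightarrow> P q \<Longrightarrow> P (p \<oplus>\<^bsub>S\<^esub> q)"
    and mult: "\<And>p q. p \<in> up R \<Longrightarrow> q \<in> up R \<Longrightarrow> P p \<Longrightarrow> P q \<Longrightarrow> P (p \<otimes>\<^bsub>S\<^esub> q)"
  shows "P p"
  using assms(1)
proof (induction p rule: up_induct)
  case (mon r k)
  show ?case
  proof (induction k)
    case 0
    then show ?case
      using assms(2)[OF mon] by (simp add: const_def)
  next
    case (Suc k)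
    have "mon r k \<otimes>\<^bsub>S\<^esub> ore_var R = mon r (Suc k)"
      using mon by (auto simp: ore_var_eq ore_mult_mon D_pow_mon_one)
    then show ?case
      using mult[OF _ _ Suc assms(3)] mon by simp
  qed
next
  case (add p q)
  then show ?case
    using assms(4)[of p q] by simp
qed

end

section \<open>The universal property of Ore extensions\<close>

locale ore_lifting = ore_data R \<sigma> \<delta> + \<phi>: alg_morph R B \<phi>
  for R :: "('k::field, 'a) module" (structure) and \<sigma> \<delta> and B :: "('k, 'b) module" and \<phi> +
  fixes t
  assumes t: "t \<in> carrier B"
    and commute: "x \<in> carrier R \<Longrightarrow> t \<otimes>\<^bsub>B\<^esub> \<phi> x = \<phi> (\<sigma> x) \<otimes>\<^bsub>B\<^esub> t \<oplus>\<^bsub>B\<^esub> \<phi> (\<delta> x)"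
begin

definition lift :: "(nat \<Rightarrow> 'a) \<Rightarrow> 'b" where
  "lift p = (\<Oplus>\<^bsub>B\<^esub>i\<in>{i. p i \<noteq> \<zero>}. \<phi> (p i) \<otimes>\<^bsub>B\<^esub> t [^]\<^bsub>B\<^esub> i)"

lemma lift_superset:
  assumes "p \<in> up R" "finite X" "{i. p i \<noteq> \<zero>} \<subseteq> X"
  shows "lift p = (\<Oplus>\<^bsub>B\<^esub>i\<in>X. \<phi> (p i) \<otimes>\<^bsub>B\<^esub> t [^]\<^bsub>B\<^esub> i)"
  unfolding lift_def
  by (rule \<phi>.B.add.finprod_mono_neutral_cong_left) (use assms t in auto)

lemma lift_closed [simp]: "p \<in> up R \<Longrightarrow> lift p \<in> carrier B"
  using t by (auto simp: lift_def intro!: \<phi>.B.finsum_closed)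

lemma lift_add:
  assumes "p \<in> up R" "q \<in> up R"
  shows "lift (\<lambda>n. p n \<oplus> q n) = lift p \<oplus>\<^bsub>B\<^esub> lift q"
proof -
  let ?X = "{i. p i \<noteq> \<zero>} \<union> {i. q i \<noteq> \<zero>}"
  have fin: "finite ?X"
    using assms by (simp add: up_finite_support)
  have "lift (\<lambda>n. p n \<oplus> q n) = (\<Oplus>\<^bsub>B\<^esub>i\<in>?X. \<phi> (p i \<oplus> q i) \<otimes>\<^bsub>B\<^esub> t [^]\<^bsub>B\<^esub> i)"
    by (rule lift_superset) (use assms fin in \<open>auto simp: up_add_closed\<close>)
  also have "\<dots> = (\<Oplus>\<^bsub>B\<^esub>i\<in>?X. \<phi> (p i) \<otimes>\<^bsub>B\<^esub> t [^]\<^bsub>B\<^esub> i \<oplus>\<^bsub>B\<^esub> \<phi> (q i) \<otimes>\<^bsub>B\<^esub> t [^]\<^bsub>B\<^esub> i)"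
    using assms t by (intro \<phi>.B.finsum_cong') (auto simp: \<phi>.B.l_distr)
  also have "\<dots> = (\<Oplus>\<^bsub>B\<^esub>i\<in>?X. \<phi> (p i) \<otimes>\<^bsub>B\<^esub> t [^]\<^bsub>B\<^esub> i) \<oplus>\<^bsub>B\<^esub> (\<Oplus>\<^bsub>B\<^esub>i\<in>?X. \<phi> (q i) \<otimes>\<^bsub>B\<^esub> t [^]\<^bsub>B\<^esub> i)"
    using assms t by (intro \<phi>.B.finsum_addf) auto
  also have "\<dots> = lift p \<oplus>\<^bsub>B\<^esub> lift q"
    using lift_superset[OF assms(1) fin] lift_superset[OF assms(2) fin] by simp
  finally show ?thesis .
qed

lemma lift_mon: "r \<in> carrier R \<Longrightarrow> lift (mon r k) = \<phi> r \<otimes>\<^bsub>B\<^esub> t [^]\<^bsub>B\<^esub> k"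
  using t by (subst lift_superset[of _ "{k}"]) auto

lemma lift_scale:
  assumes "r \<in> carrier R" "p \<in> up R"
  shows "lift (\<lambda>n. r \<otimes> p n) = \<phi> r \<otimes>\<^bsub>B\<^esub> lift p"
  using assms(2)
proof (induction p rule: up_induct)
  case (mon s k)
  have "(\<lambda>n. r \<otimes> mon s k n) = mon (r \<otimes> s) k"
    using assms(1) by auto
  then show ?case
    using mon assms t by (simp add: lift_mon \<phi>.B.m_assoc)
next
  case (add p p')
  then show ?case
    using assms by (simp add: r_distr lift_add \<phi>.B.r_distr up_smult_closed)
qed

lemma pow_commute: "t [^]\<^bsub>B\<^esub> (k::nat) \<otimes>\<^bsub>B\<^esub> t = t \<otimes>\<^bsub>B\<^esub> t [^]\<^bsub>B\<^esub> k"
  using \<phi>.B.nat_pow_Suc2[OF t, of k] by simp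

text \<open>The commutation hypothesis on \<open>t\<close> is exactly what turns the operator
  \<open>D\<close> into left multiplication by \<open>t\<close>; multiplicativity of
  \<open>lift\<close> rests on this.\<close>

lemma lift_D:
  assumes "p \<in> up R"
  shows "lift (D p) = t \<otimes>\<^bsub>B\<^esub> lift p"
  using assms
proof (induction p rule: up_induct)
  case (mon r k)
  have "t \<otimes>\<^bsub>B\<^esub> (\<phi> r \<otimes>\<^bsub>B\<^esub> t [^]\<^bsub>B\<^esub> k) = (\<phi> (\<sigma> r) \<otimes>\<^bsub>B\<^esub> t \<oplus>\<^bsub>B\<^esub> \<phi> (\<delta> r)) \<otimes>\<^bsub>B\<^esub> t [^]\<^bsub>B\<^esub> k"
    using mon t by (simp add: \<phi>.B.m_assoc[symmetric] commute)
  also have "\<dots> = \<phi> (\<sigma> r) \<otimes>\<^bsub>B\<^esub> t [^]\<^bsub>B\<^esub> Suc k \<oplus>\<^bsub>B\<^esub> \<phi> (\<delta> r) \<otimes>\<^bsub>B\<^esub> t [^]\<^bsub>B\<^esub> k"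
    using mon t
    by (simp add: \<phi>.B.l_distr \<phi>.B.m_assoc pow_commute \<sigma>_simps \<delta>_simps)
  finally show ?case
    using mon by (simp add: D_mon lift_add lift_mon \<sigma>_simps \<delta>_simps)
next
  case (add p q)
  then show ?case
    using t by (simp add: D_add lift_add \<phi>.B.r_distr)
qed

lemma lift_D_pow: "p \<in> up R \<Longrightarrow> lift ((D ^^ k) p) = t [^]\<^bsub>B\<^esub> k \<otimes>\<^bsub>B\<^esub> lift p"
  using t by (induction k)
    (simp_all add: lift_D pow_commute \<phi>.B.m_assoc)

lemma lift_mult:
  assumes "p \<in> up R" "q \<in> up R"
  shows "lift (ore_mult R \<delta> \<sigma> p q) = lift p \<otimes>\<^bsub>B\<^esub> lift q"
  using assms(1)
proof (induction p rule: up_induct)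
  case (mon r k)
  then show ?case
    using assms(2) t by (simp add: ore_mult_mon lift_scale lift_D_pow lift_mon \<phi>.B.m_assoc)
next
  case (add p p')
  then show ?case
    using assms(2) by (simp add: ore_mult_add_left lift_add \<phi>.B.l_distr)
qed

lemma lift_smult: "p \<in> up R \<Longrightarrow> lift (\<lambda>n. c \<odot> p n) = c \<odot>\<^bsub>B\<^esub> lift p"
  using lift_scale[of "scalar R c" p] by (simp add: scalar_mult \<phi>.hom_scalar \<phi>.B.scalar_mult)

lemma lift_hom: "lift \<in> alg_hom S B"
  by (rule alg_homI) (simp_all add: lift_mult lift_add lift_smult lift_mon)

lemma lift_const: "r \<in> carrier R \<Longrightarrow> lift (const r) = \<phi> r"
  by (simp add: const_def lift_mon)

lemma lift_var: "lift (ore_var R) = t"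
  using t by (simp add: ore_var_eq lift_mon)

end

subsection \<open>The automorphism and the skew derivation of \<open>\<K>\<close>\<close>

text \<open>No algebraic property of \<open>F\<close> enters, so this serves the automorphism and
  the skew derivation alike. Uniqueness holds because the projection is onto the carrier and
  extensionality fixes the values outside.\<close>

lemma presented_ex1_extensional:
  assumes "\<And>f g. presented_proj S f = presented_proj S g \<Longrightarrow>
    presented_proj S (F f) = presented_proj S (F g)"
  shows "\<exists>!h. h \<in> extensional (carrier (presented_alg S)) \<and>
    (\<forall>f. h (presented_proj S f) = presented_proj S (F f))"
proof (rule ex1I)
  define h where "h = (\<lambda>x\<in>carrier (presented_alg S).
    presented_proj S (F (SOME f. presented_proj S f = x)))"
  have h: "h (presented_proj S f) = presented_proj S (F f)" for f
  proof -
    have "presented_proj S (SOME g. presented_proj S g = presented_proj S f) = presented_proj S f"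
      by (rule someI) simp
    from assms[OF this] show ?thesis
      by (simp add: h_def)
  qed
  then show "h \<in> extensional (carrier (presented_alg S)) \<and>
      (\<forall>f. h (presented_proj S f) = presented_proj S (F f))"
    by (simp add: h_def)
  fix h1 assume h1: "h1 \<in> extensional (carrier (presented_alg S)) \<and>
    (\<forall>f. h1 (presented_proj S f) = presented_proj S (F f))"
  show "h1 = h"
  proof (rule extensionalityI)
    show "h1 \<in> extensional (carrier (presented_alg S))"
      using h1 by simp
    show "h \<in> extensional (carrier (presented_alg S))"
      by (simp add: h_def)
    show "h1 x = h x" if "x \<in> carrier (presented_alg S)" for x
      using that h1 h by (auto simp only: presented_carrier)
  qed
qed

locale K_params =
  fixes \<alpha>1 \<alpha>2 \<alpha>3 :: "'k::field"
begin

abbreviation K where "K \<equiv> K_alg \<alpha>1 \<alpha>2 \<alpha>3"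
abbreviation I where "I \<equiv> Idl\<^bsub>free_alg\<^esub> (K_rels \<alpha>1 \<alpha>2 \<alpha>3)"
abbreviation pr where "pr \<equiv> presented_proj (K_rels \<alpha>1 \<alpha>2 \<alpha>3)"

abbreviation a :: "(K_gen, 'k) free" where "a \<equiv> gen K_a"
abbreviation b :: "(K_gen, 'k) free" where "b \<equiv> gen K_b"
abbreviation c :: "(K_gen, 'k) free" where "c \<equiv> gen K_c"
abbreviation y :: "(K_gen, 'k) free" where "y \<equiv> gen K_y"

lemma K_rels_eq:
  "K_rels \<alpha>1 \<alpha>2 \<alpha>3 = {a * a - cst \<alpha>1, b * b - cst \<alpha>1, c * c - cst \<alpha>1,
      a * b + b * c + c * a - cst \<alpha>2, a * c + c * b + b * a - (cst \<alpha>2 + y), y * y * y - cst \<alpha>3}"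
  by (simp add: K_rels_def Let_def power2_eq_square power3_eq_cube)

lemma K_rels_in_ideal:
  "a * a - cst \<alpha>1 \<in> I" "b * b - cst \<alpha>1 \<in> I" "c * c - cst \<alpha>1 \<in> I"
  "a * b + b * c + c * a - cst \<alpha>2 \<in> I" "a * c + c * b + b * a - (cst \<alpha>2 + y) \<in> I"
  "y * y * y - cst \<alpha>3 \<in> I"
  by (rule genideal_self_free, simp add: K_rels_eq)+

text \<open>The generator \<open>y\<close> is redundant.\<close>

lemma K_free_induct [case_names cong a b c cst add mult]:
  assumes "\<And>f g. pr f = pr g \<Longrightarrow> P f \<Longrightarrow> P g" "P a" "P b" "P c" and cst: "\<And>k. P (cst k)"
    and add: "\<And>f g. P f \<Longrightarrow> P g \<Longrightarrow> P (f + g)" and mult: "\<And>f g. P f \<Longrightarrow> P g \<Longrightarrow> P (f * g)"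
  shows "P f"
proof (induction f rule: free_word_induct)
  case (gen x)
  \<comment> \<open>The fifth relation solved for \<open>y\<close>. Subtraction is written as adding
    \<open>cst (- \<alpha>2)\<close>, since \<open>P\<close> is closed under sums, products and
    constants.\<close>
  have "P (a * c + c * b + b * a + cst (- \<alpha>2))"
    by (intro add mult cst assms(2-4))
  moreover have "pr (a * c + c * b + b * a + cst (- \<alpha>2)) = pr y"
    using K_rels_in_ideal(5) by (simp add: presented_proj_eq_iff cst_minus diff_diff_eq)
  ultimately have "P y"
    using assms(1) by blast
  then show ?case
    using assms(2-4) by (cases x) auto
qed (simp_all add: cst add mult)

text \<open>The letter \<open>y\<close> is fixed because the products \<open>a * c\<close>,
  \<open>c * b\<close>, \<open>b * a\<close> are sent to \<open>c * b\<close>, \<open>b * a\<close>,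
  \<open>a * c\<close>.\<close>

definition sigma_lift :: "(K_gen, 'k) free \<Rightarrow> (K_gen, 'k) free" where
  "sigma_lift = nc_algebra.alg_eval free_alg (case_K_gen (- c) (- a) (- b) y)"

lemma sigma_lift_hom: "sigma_lift \<in> alg_hom free_alg free_alg"
  unfolding sigma_lift_def by (rule free_alg.alg_eval_hom) simp

lemma sigma_lift_gen: "sigma_lift a = - c" "sigma_lift b = - a" "sigma_lift c = - b"
    "sigma_lift y = y"
  unfolding sigma_lift_def by (subst free_alg.alg_eval_gen; simp)+

lemmas sigma_lift_simps = free_alg_hom[OF sigma_lift_hom] sigma_lift_gen

text \<open>The signs disappear because \<open>a\<close>, \<open>b\<close>, \<open>c\<close> occur
  in the relations only in products of two.\<close>

lemma sigma_lift_rels: "r \<in> K_rels \<alpha>1 \<alpha>2 \<alpha>3 \<Longrightarrow> sigma_lift r \<in> K_rels \<alpha>1 \<alpha>2 \<alpha>3"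
  unfolding K_rels_eq by (elim insertE emptyE; hypsubst; simp add: sigma_lift_simps add_ac)

lemma sigma_lift_ideal:
  assumes "f \<in> I"
  shows "sigma_lift f \<in> I"
proof -
  interpret p: alg_morph free_alg "presented_alg (K_rels \<alpha>1 \<alpha>2 \<alpha>3)" "pr \<circ> sigma_lift"
    by (intro alg_morph.intro alg_morph_axioms.intro free_nc_algebra presented_nc_algebra
        alg_hom_comp[OF sigma_lift_hom alg_morph.alg_hom[OF presented_proj_morph]])
  have "(pr \<circ> sigma_lift) f = \<zero>\<^bsub>presented_alg (K_rels \<alpha>1 \<alpha>2 \<alpha>3)\<^esub>"
    by (rule p.genideal_subset_kernel[OF _ _ assms])
      (simp_all add: presented_proj_eq_zero_iff genideal_self_free sigma_lift_rels)
  then show ?thesis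
    by (simp add: presented_proj_eq_zero_iff)
qed

definition partial_lift :: "(K_gen, 'k) free \<Rightarrow> (K_gen, 'k) free" where
  "partial_lift = free_skew_derivation sigma_lift (case_K_gen (cst \<alpha>2 - a * c) (cst \<alpha>2 - b * a)
      (cst \<alpha>2 - c * b) 0)"

lemma partial_lift_gen: "partial_lift a = cst \<alpha>2 - a * c" "partial_lift b = cst \<alpha>2 - b * a"
    "partial_lift c = cst \<alpha>2 - c * b" "partial_lift y = 0"
  by (simp_all add: partial_lift_def free_skew_derivation[OF sigma_lift_hom])

lemmas partial_lift_simps = free_skew_derivation[OF sigma_lift_hom,
    of "case_K_gen (cst \<alpha>2 - a * c) (cst \<alpha>2 - b * a) (cst \<alpha>2 - c * b) 0",
    folded partial_lift_def] partial_lift_gen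

lemma partial_lift_rels:
  assumes "r \<in> K_rels \<alpha>1 \<alpha>2 \<alpha>3"
  shows "partial_lift r \<in> I"
proof -
  define R1 R2 R3 R4 where R: "R1 = a * a - cst \<alpha>1" "R2 = b * b - cst \<alpha>1" "R3 = c * c - cst \<alpha>1"
    "R4 = a * b + b * c + c * a - cst \<alpha>2"
  have R_I: "R1 \<in> I" "R2 \<in> I" "R3 \<in> I" "R4 \<in> I"
    using K_rels_in_ideal by (simp_all add: R)
  \<comment> \<open>Instantiated at generators, these rules move constants to the front of a word
    and never swap two constants.\<close>
  note central = cst_central[of "gen x" for x] cst_left_commute[of "gen x" for x]
  note simps = partial_lift_simps sigma_lift_simps R algebra_simps central
  \<comment> \<open>For \<open>a * a\<close>, the difference \<open>R4 * c - a * R4\<close> exceeds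
    the goal by \<open>b * c * c - a * a * b\<close>, which \<open>R3\<close> and \<open>R1\<close>
    remove. The next two identities follow by the rotation a -> b -> c -> a, which preserves
    \<open>R4\<close> and commutes with both lifts. In the fifth, the multiples of \<alpha>1 cancel
    around the cycle.\<close>
  have "partial_lift (a * a - cst \<alpha>1) = R4 * c - a * R4 - b * R3 + R1 * b"
    "partial_lift (b * b - cst \<alpha>1) = R4 * a - b * R4 - c * R1 + R2 * c"
    "partial_lift (c * c - cst \<alpha>1) = R4 * b - c * R4 - a * R2 + R3 * a"
    "partial_lift (a * b + b * c + c * a - cst \<alpha>2) = 0"
    "partial_lift (a * c + c * b + b * a - (cst \<alpha>2 + y))
        = R3 * b - a * R3 + (R2 * a - c * R2) + (R1 * c - b * R1)"
    "partial_lift (y * y * y - cst \<alpha>3) = 0"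
    by (simp_all add: simps)
  moreover have "0 \<in> I"
    using genideal_free_closed(1)[OF R_I(1), of 0] by simp
  ultimately show ?thesis
    using assms[unfolded K_rels_eq]
    by (auto simp: genideal_free_closed(4,5) R_I[THEN genideal_free_closed(1)]
        R_I[THEN genideal_free_closed(2)])
qed

text \<open>A skew derivation is not multiplicative, so no kernel argument applies. Instead the
  elements of \<open>I\<close> whose image is in \<open>I\<close> form an ideal: in the product rule
  for \<open>g * f\<close> the term with \<open>f\<close> itself needs \<open>f\<close> in
  \<open>I\<close>, and for \<open>f * g\<close> the term
  \<open>sigma_lift f * partial_lift g\<close> needs that \<open>sigma_lift\<close> preserves
  \<open>I\<close>.\<close>

lemma partial_lift_ideal:
  assumes "f \<in> I"
  shows "partial_lift f \<in> I"
proof -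
  have "ideal {f \<in> I. partial_lift f \<in> I} free_alg"
  proof (rule idealI)
    show "ring free_alg"
      using free_nc_algebra nc_algebra.axioms(1) by blast
    have "0 \<in> I"
      using genideal_free_closed(1)[OF K_rels_in_ideal(1), of 0] by simp
    then show "subgroup {f \<in> I. partial_lift f \<in> I} (add_monoid free_alg)"
      using partial_lift_simps(5)[of 0] partial_lift_simps(6)[of 0]
      by unfold_locales (auto simp: partial_lift_simps free_alg_a_inv[unfolded a_inv_def,
          simplified] intro: genideal_free_closed)
  qed (auto simp: partial_lift_simps intro: genideal_free_closed(1,2,4) sigma_lift_ideal)
  then have "I \<subseteq> {f \<in> I. partial_lift f \<in> I}"
    by (rule free_alg.genideal_minimal) (auto simp: genideal_self_free partial_lift_rels)
  then show ?thesis
    using assms by blast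
qed

lemma sigma_lift_cong: "pr f = pr g \<Longrightarrow> pr (sigma_lift f) = pr (sigma_lift g)"
  using sigma_lift_ideal by (auto simp: presented_proj_eq_iff simp flip: sigma_lift_simps)

lemma partial_lift_cong: "pr f = pr g \<Longrightarrow> pr (partial_lift f) = pr (partial_lift g)"
  using partial_lift_ideal by (auto simp: presented_proj_eq_iff simp flip: partial_lift_simps)

lemma K_eq: "K = presented_alg (K_rels \<alpha>1 \<alpha>2 \<alpha>3)"
  by (simp add: K_alg_def)

text \<open>The third power is -1 on \<open>a\<close>, \<open>b\<close>, \<open>c\<close>
  (\<open>a\<close> goes to \<open>- c\<close>, \<open>b\<close>, \<open>- a\<close>) and the
  identity on \<open>y\<close>. This makes the fifth power an inverse, which gives bijectivity on
  K.\<close>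

lemma sigma_lift_order:
  "sigma_lift (sigma_lift (sigma_lift (sigma_lift (sigma_lift (sigma_lift f))))) = f"
proof (induction f rule: free_word_induct)
  case (gen x)
  show ?case
    by (cases x) (simp_all add: sigma_lift_simps)
qed (simp_all add: sigma_lift_simps)

text \<open>Replaces the prescription on generators by an equation for all representatives, which is
  the form that yields existence and uniqueness together.\<close>

lemma is_sigma_iff:
  "is_sigma \<alpha>1 \<alpha>2 \<alpha>3 \<sigma> \<longleftrightarrow> \<sigma> \<in> extensional (carrier K) \<and> (\<forall>f. \<sigma> (pr f) = pr (sigma_lift f))"
proof
  assume "is_sigma \<alpha>1 \<alpha>2 \<alpha>3 \<sigma>"
  then have \<sigma>: "\<sigma> \<in> alg_hom K K" "\<sigma> \<in> extensional (carrier K)"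
    and gens: "\<sigma> (pr a) = pr (- c)" "\<sigma> (pr b) = pr (- a)" "\<sigma> (pr c) = pr (- b)"
    by (auto simp: is_sigma_def Let_def alg_auto_def Bij_def pgen_eq K_eq presented_proj_ops)
  note \<sigma>_simps = alg_homD[OF \<sigma>(1)[unfolded K_eq]]
  have "\<sigma> (pr f) = pr (sigma_lift f)" for f
  proof (induction f rule: K_free_induct)
    case (cong f g)
    then show ?case
      using sigma_lift_cong by metis
  next
    case (cst k)
    then show ?case
      using \<sigma>_simps(5)[of "pr 1" k] \<sigma>_simps(4) by (simp add: presented_proj_ops sigma_lift_simps)
  next
    case (add f g)
    then show ?case
      using \<sigma>_simps(3)[of "pr f" "pr g"] by (simp add: presented_proj_ops sigma_lift_simps)
  next
    case (mult f g)
    then show ?case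
      using \<sigma>_simps(2)[of "pr f" "pr g"] by (simp add: presented_proj_ops sigma_lift_simps)
  qed (simp_all add: gens sigma_lift_simps)
  then show "\<sigma> \<in> extensional (carrier K) \<and> (\<forall>f. \<sigma> (pr f) = pr (sigma_lift f))"
    using \<sigma> by simp
next
  assume \<sigma>: "\<sigma> \<in> extensional (carrier K) \<and> (\<forall>f. \<sigma> (pr f) = pr (sigma_lift f))"
  have "\<sigma> \<in> alg_hom K K"
    by (rule alg_homI) (auto simp: K_eq presented_carrier presented_proj_ops \<sigma> sigma_lift_simps)
  moreover have "bij_betw \<sigma> (carrier K) (carrier K)"
    by (rule bij_betw_byWitness[of _ "\<lambda>x. \<sigma> (\<sigma> (\<sigma> (\<sigma> (\<sigma> x))))"])
      (auto simp: K_eq presented_carrier \<sigma> sigma_lift_order)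
  ultimately show "is_sigma \<alpha>1 \<alpha>2 \<alpha>3 \<sigma>"
    using \<sigma> by (simp add: is_sigma_def Let_def alg_auto_def Bij_def pgen_eq K_eq
        presented_proj_ops sigma_lift_simps)
qed

lemma ex1_sigma: "\<exists>!\<sigma>. is_sigma \<alpha>1 \<alpha>2 \<alpha>3 \<sigma>"
  unfolding is_sigma_iff K_eq by (rule presented_ex1_extensional) (rule sigma_lift_cong)

lemma is_partial_iff:
  assumes "is_sigma \<alpha>1 \<alpha>2 \<alpha>3 \<sigma>"
  shows "is_partial \<alpha>1 \<alpha>2 \<alpha>3 \<sigma> \<delta> \<longleftrightarrow> \<delta> \<in> extensional (carrier K) \<and> (\<forall>f. \<delta> (pr f)
      = pr (partial_lift f))"
proof
  have \<sigma>: "\<sigma> (pr f) = pr (sigma_lift f)" for f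
    using assms by (simp add: is_sigma_iff)
  {
    assume "is_partial \<alpha>1 \<alpha>2 \<alpha>3 \<sigma> \<delta>"
    then have \<delta>: "\<delta> \<in> skew_derivation K \<sigma>"
      and gens: "\<delta> (pr a) = pr (cst \<alpha>2 - a * c)" "\<delta> (pr b) = pr (cst \<alpha>2 - b * a)"
        "\<delta> (pr c) = pr (cst \<alpha>2 - c * b)"
      by (simp_all add: is_partial_def Let_def pgen_eq K_eq presented_proj_ops)
    have closed: "\<delta> (pr f) \<in> range pr" for f
      using skew_derivationD(1)[OF \<delta>, of "pr f"] by (simp add: K_eq presented_carrier)
    note \<delta>_simps = skew_derivationD[OF \<delta>[unfolded K_eq]]
    have zero: "\<delta> (pr (cst 0)) = pr 0"
      using \<delta>_simps(3)[of "pr 1" 0] closed[of 1] by (auto simp: presented_proj_ops)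
    \<comment> \<open>The product rule at 1 * 1 gives
      \<open>\<delta> 1 = \<delta> 1 + \<delta> 1\<close>, and linearity then kills all constants.
      \<open>K_subst\<close> is here a local name for a representative of
      \<open>\<delta> 1\<close>.\<close>
    have one: "\<delta> (pr 1) = pr 0"
    proof -
      obtain K_subst where K_subst: "\<delta> (pr 1) = pr K_subst"
        using closed by blast
      then have "pr K_subst = pr (K_subst + K_subst)"
        using \<delta>_simps(4)[of "pr 1" "pr 1"] by (simp add: presented_proj_ops \<sigma> sigma_lift_simps)
      then have "pr 0 = pr K_subst"
        by (simp add: presented_proj_eq_iff)
      then show ?thesis
        using K_subst by simp
    qed
    have "\<delta> (pr f) = pr (partial_lift f)" for f
    proof (induction f rule: K_free_induct)
      case (cong f g)
      then show ?case
        using partial_lift_cong by metis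
    next
      case (cst k)
      then show ?case
        using \<delta>_simps(3)[of "pr 1" k] one by (simp add: presented_proj_ops partial_lift_simps)
    next
      case (add f g)
      then show ?case
        using \<delta>_simps(2)[of "pr f" "pr g"] by (simp add: presented_proj_ops partial_lift_simps)
    next
      case (mult f g)
      then show ?case
        using \<delta>_simps(4)[of "pr f" "pr g"] by (simp add: presented_proj_ops partial_lift_simps \<sigma>)
    qed (simp_all add: gens partial_lift_simps)
    then show "\<delta> \<in> extensional (carrier K) \<and> (\<forall>f. \<delta> (pr f) = pr (partial_lift f))"
      using \<delta> by (simp add: skew_derivation_def)
  }
  assume \<delta>: "\<delta> \<in> extensional (carrier K) \<and> (\<forall>f. \<delta> (pr f) = pr (partial_lift f))"
  then show "is_partial \<alpha>1 \<alpha>2 \<alpha>3 \<sigma> \<delta>"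
    by (auto simp: is_partial_def Let_def skew_derivation_def pgen_eq K_eq presented_carrier
        presented_proj_ops \<sigma> partial_lift_simps sigma_lift_simps)
qed

lemma ex1_partial:
  assumes "is_sigma \<alpha>1 \<alpha>2 \<alpha>3 \<sigma>"
  shows "\<exists>!\<delta>. is_partial \<alpha>1 \<alpha>2 \<alpha>3 \<sigma> \<delta>"
  unfolding is_partial_iff[OF assms] K_eq
  by (rule presented_ex1_extensional) (rule partial_lift_cong)

end

subsection \<open>The isomorphism\<close>

context K_params
begin

abbreviation T where "T \<equiv> T_alg \<alpha>1 \<alpha>2 \<alpha>3"
abbreviation prT where "prT \<equiv> presented_proj (T_rels \<alpha>1 \<alpha>2 \<alpha>3)"

abbreviation A :: "(T_gen, 'k) free" where "A \<equiv> gen T_a"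
abbreviation B :: "(T_gen, 'k) free" where "B \<equiv> gen T_b"
abbreviation C :: "(T_gen, 'k) free" where "C \<equiv> gen T_c"
abbreviation D :: "(T_gen, 'k) free" where "D \<equiv> gen T_d"

lemma T_eq: "T = presented_alg (T_rels \<alpha>1 \<alpha>2 \<alpha>3)"
  by (simp add: T_alg_def)

text \<open>The image of \<open>y\<close> is the fifth relation of K solved for \<open>y\<close>, so
  that relation becomes the identity 0 = 0 and the cubic relation of T becomes the image of the one
  for \<open>y\<close>.\<close>

definition K_subst :: "(K_gen, 'k) free \<Rightarrow> (T_gen, 'k) free" where
  "K_subst = nc_algebra.alg_eval free_alg (case_K_gen A B C (C * B + B * A + A * C - cst \<alpha>2))"

lemma K_subst_hom: "K_subst \<in> alg_hom free_alg free_alg"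
  unfolding K_subst_def by (rule free_alg.alg_eval_hom) simp

lemma K_subst_gen: "K_subst a = A" "K_subst b = B" "K_subst c = C"
    "K_subst y = C * B + B * A + A * C - cst \<alpha>2"
  unfolding K_subst_def by (subst free_alg.alg_eval_gen; simp)+

lemmas K_subst_simps = free_alg_hom[OF K_subst_hom] K_subst_gen

text \<open>Apart from \<open>D * D - cst \<alpha>1\<close>, every relation of T is either the image
  of a relation of K or a commutation rule at a letter, so arguments about T can be run over the
  free algebra of K.\<close>

lemma T_rels_eq:
  "T_rels \<alpha>1 \<alpha>2 \<alpha>3 =
    {K_subst (a * a - cst \<alpha>1), K_subst (b * b - cst \<alpha>1), K_subst (c * c - cst \<alpha>1), D * D - cst \<alpha>1,
     K_subst (c * a + b * c + a * b - cst \<alpha>2),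
     D * K_subst a - (K_subst (sigma_lift a) * D + K_subst (partial_lift a)),
     D * K_subst b - (K_subst (sigma_lift b) * D + K_subst (partial_lift b)),
     D * K_subst c - (K_subst (sigma_lift c) * D + K_subst (partial_lift c)),
     K_subst (y * y * y - cst \<alpha>3)}"
  by (simp add: T_rels_def Let_def power2_eq_square power3_eq_cube K_subst_simps sigma_lift_simps
      partial_lift_simps diff_add_eq diff_diff_eq2 add_ac)

lemma T_rels_zero: "r \<in> T_rels \<alpha>1 \<alpha>2 \<alpha>3 \<Longrightarrow> prT r = prT 0"
  using genideal_self_free[of r "T_rels \<alpha>1 \<alpha>2 \<alpha>3"] by (simp add: presented_proj_eq_iff)

lemma K_subst_rels_in_T_rels:
  "K_subst (a * a - cst \<alpha>1) \<in> T_rels \<alpha>1 \<alpha>2 \<alpha>3" "K_subst (b * b - cst \<alpha>1) \<in> T_rels \<alpha>1 \<alpha>2 \<alpha>3"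
  "K_subst (c * c - cst \<alpha>1) \<in> T_rels \<alpha>1 \<alpha>2 \<alpha>3"
  "K_subst (c * a + b * c + a * b - cst \<alpha>2) \<in> T_rels \<alpha>1 \<alpha>2 \<alpha>3"
  "K_subst (y * y * y - cst \<alpha>3) \<in> T_rels \<alpha>1 \<alpha>2 \<alpha>3"
  by (simp_all add: T_rels_eq)

lemma K_subst_rels:
  assumes "r \<in> K_rels \<alpha>1 \<alpha>2 \<alpha>3"
  shows "prT (K_subst r) = prT 0"
proof -
  have "K_subst (a * b + b * c + c * a - cst \<alpha>2) = K_subst (c * a + b * c + a * b - cst \<alpha>2)"
    "K_subst (a * c + c * b + b * a - (cst \<alpha>2 + y)) = 0"
    by (simp_all add: K_subst_simps add_ac)
  then show ?thesis
    using assms K_subst_rels_in_T_rels unfolding K_rels_eq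
    by (elim insertE emptyE; hypsubst) (simp_all add: T_rels_zero)
qed

lemma K_to_T:
  obtains \<phi> where "\<phi> \<in> alg_hom K T" "\<And>f. \<phi> (pr f) = prT (K_subst f)"
proof -
  have "alg_morph free_alg T (prT \<circ> K_subst)"
    unfolding T_eq
    by (intro alg_morph.intro alg_morph_axioms.intro free_nc_algebra presented_nc_algebra
        alg_hom_comp[OF K_subst_hom alg_morph.alg_hom[OF presented_proj_morph]])
  then show ?thesis
  proof (rule presented_lift)
    show "(prT \<circ> K_subst) r = \<zero>\<^bsub>T\<^esub>" if "r \<in> K_rels \<alpha>1 \<alpha>2 \<alpha>3" for r
      using K_subst_rels[OF that] by (simp add: T_eq presented_proj_ops)
  next
    fix \<phi> assume "\<phi> \<in> alg_hom (presented_alg (K_rels \<alpha>1 \<alpha>2 \<alpha>3)) T"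
        "\<And>f. \<phi> (pr f) = (prT \<circ> K_subst) f"
    then show thesis
      by (intro that) (simp_all add: K_eq)
  qed
qed

lemma K_subst_cong: "pr f = pr g \<Longrightarrow> prT (K_subst f) = prT (K_subst g)"
  using K_to_T by metis

text \<open>The rule propagates to products, since moving \<open>D\<close> past \<open>f\<close> and
  then past \<open>g\<close> reproduces the product rule of \<open>partial_lift\<close>. It is
  needed for all \<open>f\<close> in order to apply the universal property of the Ore
  extension.\<close>

lemma prT_commute: "prT (D * K_subst f)
    = prT (K_subst (sigma_lift f) * D + K_subst (partial_lift f))"
proof (induction f rule: K_free_induct)
  \<comment> \<open>This case covers \<open>y\<close>, for which T has no commutation relation of
    its own; it uses that all three maps respect the relations of K.\<close>
  case (cong f g)
  have "prT (D * K_subst g) = prT (D * K_subst f)"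
    by (intro presented_proj_cong refl K_subst_cong cong(1)[symmetric])
  also note cong(2)
  also have "prT (K_subst (sigma_lift f) * D + K_subst (partial_lift f))
      = prT (K_subst (sigma_lift g) * D + K_subst (partial_lift g))"
    by (intro presented_proj_cong refl K_subst_cong sigma_lift_cong partial_lift_cong cong(1))
  finally show ?case .
next
  case (cst k)
  show ?case
    by (simp add: K_subst_simps sigma_lift_simps partial_lift_simps cst_central)
next
  case (add f g)
  have "prT (D * K_subst (f + g)) = prT (D * K_subst f + D * K_subst g)"
    by (simp add: K_subst_simps algebra_simps)
  also have "\<dots> = prT ((K_subst (sigma_lift f) * D + K_subst (partial_lift f)) +
      (K_subst (sigma_lift g) * D + K_subst (partial_lift g)))"
    by (intro presented_proj_cong add)
  finally show ?case
    by (simp add: K_subst_simps sigma_lift_simps partial_lift_simps algebra_simps)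
next
  case (mult f g)
  have "prT (D * K_subst (f * g)) = prT ((D * K_subst f) * K_subst g)"
    by (simp add: K_subst_simps mult.assoc)
  also have "\<dots> = prT ((K_subst (sigma_lift f) * D + K_subst (partial_lift f)) * K_subst g)"
    by (intro presented_proj_cong mult refl)
  also have "\<dots> = prT (K_subst (sigma_lift f) * (D * K_subst g) +
      K_subst (partial_lift f) * K_subst g)"
    by (simp add: algebra_simps)
  also have "\<dots> = prT (K_subst (sigma_lift f) * (K_subst (sigma_lift g) * D +
      K_subst (partial_lift g)) + K_subst (partial_lift f) * K_subst g)"
    by (intro presented_proj_cong mult refl)
  finally show ?case
    by (simp add: K_subst_simps sigma_lift_simps partial_lift_simps algebra_simps)
qed (simp_all add: presented_proj_eq_iff genideal_self_free T_rels_eq)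

lemma T_isomorphic_ore_quot:
  assumes \<sigma>_eq: "is_sigma \<alpha>1 \<alpha>2 \<alpha>3 \<sigma>" and \<delta>_eq: "is_partial \<alpha>1 \<alpha>2 \<alpha>3 \<sigma> \<delta>"
  shows "alg_isomorphic T (ore_quot K \<delta> \<sigma> \<alpha>1)"
proof -
  have \<sigma>: "\<sigma> (pr f) = pr (sigma_lift f)" and \<delta>: "\<delta> (pr f) = pr (partial_lift f)" for f
    using assms by (simp_all add: is_sigma_iff is_partial_iff)
  have nc_K: "nc_algebra K"
    by (simp add: K_eq presented_nc_algebra)
  have "\<sigma> \<in> alg_hom K K" "\<delta> \<in> skew_derivation K \<sigma>"
    using assms by (simp_all add: is_sigma_def is_partial_def alg_auto_def Let_def)
  then interpret O: ore_data K \<sigma> \<delta>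
    by (intro ore_data.intro ore_data_axioms.intro nc_K)
  obtain \<phi> where \<phi>: "\<phi> \<in> alg_hom K T" "\<And>f. \<phi> (pr f) = prT (K_subst f)"
    using K_to_T by blast
  interpret T: alg_morph free_alg T prT
    unfolding T_eq by (rule presented_proj_morph)
  \<comment> \<open>The map from the Ore extension to T sending \<open>d\<close> to
    \<open>prT D\<close>.\<close>
  interpret L: ore_lifting K \<sigma> \<delta> T \<phi> "prT D"
  proof (intro ore_lifting.intro ore_lifting_axioms.intro alg_morph.intro alg_morph_axioms.intro)
    fix x assume "x \<in> carrier K"
    then obtain f where "x = pr f"
      by (auto simp: K_eq presented_carrier)
    then show "prT D \<otimes>\<^bsub>T\<^esub> \<phi> x = \<phi> (\<sigma> x) \<otimes>\<^bsub>T\<^esub> prT D \<oplus>\<^bsub>T\<^esub> \<phi> (\<delta> x)"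
      using prT_commute[of f] by (simp add: \<phi>(2) \<sigma> \<delta> T_eq presented_proj_ops)
  qed (use \<phi>(1) O.ore_data_axioms nc_K T.B.nc_algebra_axioms in \<open>simp_all add: T_eq\<close>)
  let ?S = "ore_ext K \<delta> \<sigma>" and ?t = "ore_var K"
  note [simp del] = O.ore_ext_simps O.ore_ext_add
  have carrier_S: "carrier ?S = up K"
    by (rule O.ore_ext_simps)
  have t_closed: "?t \<in> carrier ?S"
    by (simp add: carrier_S)
  define \<kappa> where "\<kappa> = O.const \<circ> pr"
  interpret S: nc_algebra ?S
    by (rule O.ore_ext_nc_algebra)
  have pr_hom: "pr \<in> alg_hom free_alg K"
    unfolding K_eq by (rule alg_morph.alg_hom[OF presented_proj_morph])
  interpret \<kappa>: alg_morph free_alg ?S \<kappa>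
    unfolding \<kappa>_def
    by (intro alg_morph.intro alg_morph_axioms.intro free_nc_algebra S.nc_algebra_axioms
        alg_hom_comp[OF pr_hom O.const_hom])
  define G where "G = case_T_gen (\<kappa> a) (\<kappa> b) (\<kappa> c) ?t"
  have G_closed: "G x \<in> carrier ?S" for x
    by (cases x) (simp_all add: G_def t_closed)
  \<comment> \<open>The values lie in the Ore extension itself: all relations of T other than that
    for \<open>D * D\<close> already vanish there, and only this one is left to the
    quotient.\<close>
  define E where "E = S.alg_eval G"
  interpret E: alg_morph free_alg ?S E
    unfolding E_def
    by (intro alg_morph.intro alg_morph_axioms.intro free_nc_algebra S.nc_algebra_axioms
        S.alg_eval_hom G_closed)
  have E_gen: "E A = \<kappa> a" "E B = \<kappa> b" "E C = \<kappa> c" "E D = ?t"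
    by (simp_all only: E_def S.alg_eval_gen[of G, OF G_closed]) (simp_all add: G_def)
  have E_add: "E (f + f') = E f \<oplus>\<^bsub>?S\<^esub> E f'" and E_mult: "E (f * f') = E f \<otimes>\<^bsub>?S\<^esub> E f'"
    and E_minus: "E (f - f') = E f \<ominus>\<^bsub>?S\<^esub> E f'" and E_cst: "E (cst k) = scalar ?S k" for f f' k
    using E.hom_add[of f f'] E.hom_mult[of f f'] E.hom_minus[of f f'] E.hom_scalar[of k] by simp_all
  have E_closed: "E f \<in> carrier ?S" for f
    using E.hom_closed[of f] by simp
  have E_K_subst_add: "E (K_subst (f + f')) = \<kappa> (f + f')" if "E (K_subst f) = \<kappa> f"
      "E (K_subst f') = \<kappa> f'" for f f'
    using that \<kappa>.hom_add[of f f'] by (simp add: K_subst_simps E_add)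
  have E_K_subst_mult: "E (K_subst (f * f')) = \<kappa> (f * f')" if "E (K_subst f) = \<kappa> f"
      "E (K_subst f') = \<kappa> f'" for f f'
    using that \<kappa>.hom_mult[of f f'] by (simp add: K_subst_simps E_mult)
  have E_K_subst_cst: "E (K_subst (cst k)) = \<kappa> (cst k)" for k
    using \<kappa>.hom_scalar[of k] by (simp add: K_subst_simps E_cst)
  have E_K_subst_gen: "E (K_subst a) = \<kappa> a" "E (K_subst b) = \<kappa> b" "E (K_subst c) = \<kappa> c"
    by (simp_all add: K_subst_simps E_gen)
  have E_K_subst: "E (K_subst f) = \<kappa> f" for f
  proof (induction f rule: free_word_induct)
    case (gen x)
    have "E (K_subst (c * b + b * a + a * c + cst (- \<alpha>2))) = \<kappa> (c * b + b * a + a * c + cst (- \<alpha>2))"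
      by (intro E_K_subst_add E_K_subst_mult E_K_subst_cst E_K_subst_gen)
    moreover have "K_subst (c * b + b * a + a * c + cst (- \<alpha>2)) = K_subst y"
      by (simp add: K_subst_simps cst_minus)
    \<comment> \<open>Only a congruence modulo the relations of K is available here; it suffices
      because \<open>\<kappa>\<close> factors through \<open>pr\<close>.\<close>
    moreover have "pr (c * b + b * a + a * c + cst (- \<alpha>2)) = pr y"
      using K_rels_in_ideal(5) by (simp add: presented_proj_eq_iff cst_minus diff_diff_eq add_ac)
    ultimately have "E (K_subst y) = \<kappa> y"
      by (simp add: \<kappa>_def)
    then show ?case
      using E_K_subst_gen by (cases x) simp_all
  qed (simp_all add: E_K_subst_add E_K_subst_mult E_K_subst_cst)
  define J where "J = Idl\<^bsub>?S\<^esub> {?t [^]\<^bsub>?S\<^esub> (2::nat) \<ominus>\<^bsub>?S\<^esub> scalar ?S \<alpha>1}"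
  \<comment> \<open>With the generator of \<open>J\<close> written as the image of a relation of T,
    the map back to T kills \<open>J\<close> by \<open>lift_E\<close>.\<close>
  have rel: "?t [^]\<^bsub>?S\<^esub> (2::nat) \<ominus>\<^bsub>?S\<^esub> scalar ?S \<alpha>1 = E (D * D - cst \<alpha>1)"
    using t_closed by (simp add: E_minus E_mult E_cst E_gen numeral_2_eq_2)
  have J: "ideal J ?S"
    unfolding J_def rel by (rule S.genideal_ideal) (simp add: E_closed)
  define q where "q = (+>\<^bsub>?S\<^esub>) J"
  let ?Q = "ore_quot K \<delta> \<sigma> \<alpha>1"
  have Q: "?Q = alg_quot ?S J"
    by (simp add: ore_quot_def J_def Let_def)
  interpret q: alg_morph ?S ?Q q
    unfolding Q q_def using J by (rule S.alg_quot_proj_morph)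
  have q_K_subst: "q (E (K_subst f)) = \<zero>\<^bsub>?Q\<^esub>" if "f \<in> I" for f
  proof -
    have "pr f = pr 0"
      using that by (simp add: presented_proj_eq_iff)
    then have "E (K_subst f) = \<kappa> 0"
      by (simp add: E_K_subst \<kappa>_def)
    then show ?thesis
      using \<kappa>.hom_zero q.hom_zero by simp
  qed
  have q_commute: "q (E (D * K_subst f - (K_subst (sigma_lift f) * D + K_subst (partial_lift f))))
      = \<zero>\<^bsub>?Q\<^esub>" for f
  proof -
    have "?t \<otimes>\<^bsub>?S\<^esub> \<kappa> f = \<kappa> (sigma_lift f) \<otimes>\<^bsub>?S\<^esub> ?t \<oplus>\<^bsub>?S\<^esub> \<kappa> (partial_lift f)"
      using O.ore_var_const[of "pr f"] by (simp add: \<kappa>_def \<sigma> \<delta> K_eq)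
    then have "E (D * K_subst f) = E (K_subst (sigma_lift f) * D + K_subst (partial_lift f))"
      by (simp only: E_add E_mult E_K_subst E_gen)
    then have "E (D * K_subst f - (K_subst (sigma_lift f) * D + K_subst (partial_lift f))) = \<zero>\<^bsub>?S\<^esub>"
      using S.minus_eq_zero_iff E_closed by (simp only: E_minus)
    then show ?thesis
      using q.hom_zero by simp
  qed
  have q_square: "q (E (D * D - cst \<alpha>1)) = \<zero>\<^bsub>?Q\<^esub>"
    using S.genideal_self'[OF E_closed, of "D * D - cst \<alpha>1"]
      S.alg_quot_proj_eq_zero_iff[OF J E_closed]
    by (simp add: q_def Q J_def rel)
  have "c * a + b * c + a * b - cst \<alpha>2 \<in> I"
    using K_rels_in_ideal(4) by (simp add: add_ac)
  then have E_rels: "q (E r) = \<zero>\<^bsub>?Q\<^esub>" if "r \<in> T_rels \<alpha>1 \<alpha>2 \<alpha>3" for r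
    using that unfolding T_rels_eq
    by (elim insertE emptyE; hypsubst)
      (intro q_K_subst q_commute q_square K_rels_in_ideal | assumption)+
  have "alg_morph free_alg ?Q (q \<circ> E)"
    by (intro alg_morph.intro alg_morph_axioms.intro free_nc_algebra q.B.nc_algebra_axioms
        alg_hom_comp[OF E.alg_hom q.alg_hom])
  then obtain h where "h \<in> alg_hom (presented_alg (T_rels \<alpha>1 \<alpha>2 \<alpha>3)) ?Q" "\<And>f. h (prT f) = (q \<circ> E) f"
    by (rule presented_lift[where S = "T_rels \<alpha>1 \<alpha>2 \<alpha>3"]) (simp_all add: E_rels)
  then have h: "h \<in> alg_hom T ?Q" "\<And>f. h (prT f) = q (E f)"
    by (simp_all add: T_eq)
  interpret lift: alg_morph ?S T L.lift
    using L.lift_hom by unfold_locales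
  have lift_\<kappa>: "L.lift (\<kappa> f) = prT (K_subst f)" for f
    using alg_homD(1)[OF pr_hom, of f] by (simp add: \<kappa>_def L.lift_const \<phi>(2))
  \<comment> \<open>This yields that \<open>g\<close> after \<open>h\<close> is the identity of
    T.\<close>
  have lift_E: "L.lift (E f) = prT f" for f
  proof (induction f rule: free_word_induct)
    case (gen x)
    show ?case
      by (cases x) (simp_all add: E_gen lift_\<kappa> K_subst_simps L.lift_var)
  next
    case (cst k)
    show ?case
      using T.hom_scalar[of k] by (simp add: E_cst lift.hom_scalar)
  next
    case (add f f')
    then show ?case
      using T.hom_add[of f f'] lift.hom_add[OF E_closed E_closed] by (simp add: E_add)
  next
    case (mult f f')
    then show ?case
      using T.hom_mult[of f f'] lift.hom_mult[OF E_closed E_closed] by (simp add: E_mult)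
  qed
  have lift_J: "L.lift p = \<zero>\<^bsub>T\<^esub>" if "p \<in> J" for p
  proof (rule lift.genideal_subset_kernel[OF _ _ that[unfolded J_def rel]])
    show "L.lift x = \<zero>\<^bsub>T\<^esub>" if "x \<in> {E (D * D - cst \<alpha>1)}" for x
    proof -
      have "prT (D * D - cst \<alpha>1) = \<zero>\<^bsub>T\<^esub>"
        unfolding T_eq presented_proj_eq_zero_iff by (rule genideal_self_free) (simp add: T_rels_eq)
      then show ?thesis
        using that by (simp add: lift_E)
    qed
  qed (simp add: E_closed)
  obtain g where g: "g \<in> alg_hom ?Q T" "\<And>p. p \<in> carrier ?S \<Longrightarrow> g (q p) = L.lift p"
    using lift.alg_quot_lift[OF J lift_J] unfolding Q q_def by blast
  interpret h: alg_morph T ?Q h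
    using h(1) by unfold_locales
  \<comment> \<open>Both sides are homomorphisms on the Ore extension, compared on coefficients and
    variable; it yields that \<open>h\<close> after \<open>g\<close> is the identity of the
    quotient.\<close>
  have h_lift: "h (L.lift p) = q p" if "p \<in> up K" for p
    using that
  proof (induction p rule: O.ore_induct)
    case (const r)
    then obtain f where "r = pr f"
      by (auto simp: K_eq presented_carrier)
    then show ?case
      using lift_\<kappa>[of f] E_K_subst[of f] by (simp add: h(2) \<kappa>_def)
  next
    case var
    then show ?case
      by (simp add: L.lift_var h(2) E_gen)
  next
    case (add p p')
    then show ?case
      by (simp add: lift.hom_add h.hom_add q.hom_add carrier_S)
  next
    case (mult p p')
    then show ?case
      by (simp add: carrier_S)
  qed
  have carrier_T: "carrier T = range prT"
    by (simp add: T_eq presented_carrier)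
  have "bij_betw h (carrier T) (carrier ?Q)"
  proof (rule bij_betw_byWitness)
    show "\<forall>x\<in>carrier T. g (h x) = x"
      by (auto simp: carrier_T h(2) g(2) E_closed lift_E)
    show "\<forall>x\<in>carrier ?Q. h (g x) = x"
      using S.alg_quot_carrier[of J]
      by (auto simp: Q g(2)[unfolded q_def] h_lift[unfolded q_def] carrier_S
          simp del: alg_quot_simps)
    show "h ` carrier T \<subseteq> carrier ?Q" "g ` carrier ?Q \<subseteq> carrier T"
      using alg_homD(1)[OF h(1)] alg_homD(1)[OF g(1)] by blast+
  qed
  with h(1) show ?thesis
    unfolding alg_isomorphic_def by blast
qed

end

text \<open>The definite articles for the automorphism and the skew derivation are rendered as
  unique existence, and the isomorphism is asserted for whatever maps satisfy the two
  prescriptions.\<close>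

theorem proposition4p8:
  fixes \<alpha>1 \<alpha>2 \<alpha>3 :: "'k::alg_closed_field"
  assumes "CHAR('k) \<noteq> 2" and "CHAR('k) \<noteq> 3"
  shows "(\<exists>!\<sigma>. is_sigma \<alpha>1 \<alpha>2 \<alpha>3 \<sigma>) \<and>
    (\<forall>\<sigma>. is_sigma \<alpha>1 \<alpha>2 \<alpha>3 \<sigma> \<longrightarrow>
      (\<exists>!\<delta>. is_partial \<alpha>1 \<alpha>2 \<alpha>3 \<sigma> \<delta>) \<and>
      (\<forall>\<delta>. is_partial \<alpha>1 \<alpha>2 \<alpha>3 \<sigma> \<delta> \<longrightarrow>
        alg_isomorphic (T_alg \<alpha>1 \<alpha>2 \<alpha>3) (ore_quot (K_alg \<alpha>1 \<alpha>2 \<alpha>3) \<delta> \<sigma> \<alpha>1)))"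
  using K_params.ex1_sigma K_params.ex1_partial K_params.T_isomorphic_ore_quot by blast

end
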